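(* Let $n \ge 3$ be an integer with canonical prime factorization $n = p_1^{e_1}\cdots p_l^{e_l}$, and let $D = \gcd(p_1 - 1, \ldots, p_l - 1)$. There exists a rotational first-kind Frobenius circulant with kernel $\mathbb{Z}_n$ and degree $d$ if and only if $n$ is odd and $d$ is an even divisor of $D$. Moreover, if $n$ is odd and $d$ is an even divisor of $D$, then there are precisely $\varphi(d)^{l-1}$ pairwise non-isomorphic rotational first-kind Frobenius circulants of degree $d$ with kernel $\mathbb{Z}_n$ (where $\varphi$ is Euler's totient function). Each of these circulants is isomorphic to $\mathrm{Cay}(\mathbb{Z}_n, \langle [h] \rangle)$ for some $[h] \in \mathbb{Z}_n^*$ of the form $$h = \sum_{i=1}^l \frac{n}{p_i^{e_i}}\, b_i h_i,$$ where $b_i$ and $h_i$ are integers satisfying $b_i (n/p_i^{e_i}) \equiv 1 \pmod{p_i^{e_i}}$ and $h_i \equiv \eta_i^{m_i \varphi(p_i^{e_i})/d} \pmod{p_i^{e_i}}$, for a fixed primitive root $\eta_i$ modulo $p_i^{e_i}$ and an integer $m_i$ coprime to $d$. Furthermore, each such circulant is a first-kind $\mathbb{Z}_n \rtimes \mathbb{Z}_d$-Frobenius graph that admits $[h]$ as a complete rotation.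
   Context: $\mathbb{Z}_n$ is the additive group of integers mod $n$, and $\mathbb{Z}_n^* \cong \mathrm{Aut}(\mathbb{Z}_n)$ is its group of units, acting on $\mathbb{Z}_n$ by multiplication; $\langle [h]\rangle$ is the cyclic subgroup of $\mathbb{Z}_n^*$ generated by $[h]$, viewed as a subset of $\mathbb{Z}_n$. For a group $G$ and $S \subseteq G$ with $1 \notin S$, $S = S^{-1}$, the Cayley graph $\mathrm{Cay}(G,S)$ has vertex set $G$, with $g,h$ adjacent iff $gh^{-1} \in S$; a circulant is a Cayley graph on a cyclic group. A complete rotation of $\mathrm{Cay}(G,S)$ is an automorphism $\omega$ of the group $G$ with $S^\omega = S$ such that $\omega$ permutes $S$ cyclically, i.e. $\{s, s^\omega, \ldots, s^{\omega^{|S|-1}}\} = S$ for some (equivalently every) $s \in S$; the graph is rotational if it admits a complete rotation. A Frobenius group is a transitive, non-regular permutation group in which only the identity fixes two points. For a subgroup $H \le \mathbb{Z}_n^*$ such that $\mathbb{Z}_n \rtimes H$ (acting on $\mathbb{Z}_n$ by $[x]^{([y],[u])} = [(x+y)u]$) is a Frobenius group, a first-kind $\mathbb{Z}_n \rtimes H$-Frobenius graph is a connected circulant $\mathrm{Cay}(\mathbb{Z}_n, S)$ with $S = a^H$ (the $H$-orbit of some $a \in \mathbb{Z}_n$) and $\langle a^H\rangle = \mathbb{Z}_n$, where $|H|$ is even or $a$ is an involution; such a graph is called a first-kind Frobenius circulant with kernel $\mathbb{Z}_n$ and complement $H$. (Equivalently: a connected $\mathrm{Cay}(\mathbb{Z}_n,S)$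 together with $H \le \mathbb{Z}_n^*$ regular on $S$ and semiregular on $\mathbb{Z}_n\setminus\{[0]\}$.) The notation $\mathbb{Z}_n \rtimes \mathbb{Z}_d$ means $\mathbb{Z}_n \rtimes H$ with $H$ cyclic of order $d$. *)

theory Defs
  imports
    "HOL-Number_Theory.Number_Theory"
    "HOL-Algebra.Elementary_Groups"
    "HOL-Algebra.Bij"
    "Graph_Theory.Graph_Theory"
begin

subsection \<open>Cayley graphs and complete rotations\<close>

definition connection_set :: "('a, 'm) monoid_scheme \<Rightarrow> 'a set \<Rightarrow> bool" where
  "connection_set G S \<longleftrightarrow> S \<subseteq> carrier G \<and> \<one>\<^bsub>G\<^esub> \<notin> S \<and> set_inv\<^bsub>G\<^esub> S = S"

text \<open>An undirected edge is represented by its two opposite arcs, so that \<^const>\<open>out_degree\<close> is the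
  number of neighbours and \<^const>\<open>digraph_iso\<close> is isomorphism of simple graphs.\<close>

definition cayley_graph :: "('a, 'm) monoid_scheme \<Rightarrow> 'a set \<Rightarrow> 'a pair_pre_digraph" where
  "cayley_graph G S =
     \<lparr>pverts = carrier G,
      parcs = {(g, h). g \<in> carrier G \<and> h \<in> carrier G \<and> g \<otimes>\<^bsub>G\<^esub> inv\<^bsub>G\<^esub> h \<in> S}\<rparr>"

definition has_degree :: "'a pair_pre_digraph \<Rightarrow> nat \<Rightarrow> bool" where
  "has_degree \<Gamma> d \<longleftrightarrow> (\<forall>v \<in> pverts \<Gamma>. out_degree (with_proj \<Gamma>) v = d)"

definition isomorphic_graphs :: "'a pair_pre_digraph \<Rightarrow> 'a pair_pre_digraph \<Rightarrow> bool" where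
  "isomorphic_graphs \<Gamma> \<Delta> \<longleftrightarrow> digraph_iso (with_proj \<Gamma>) (with_proj \<Delta>)"

definition complete_rotation ::
  "('a, 'm) monoid_scheme \<Rightarrow> 'a set \<Rightarrow> ('a \<Rightarrow> 'a) \<Rightarrow> bool" where
  "complete_rotation G S \<omega> \<longleftrightarrow>
     \<omega> \<in> auto G \<and> \<omega> ` S = S \<and> (\<exists>s \<in> S. (\<lambda>i. (\<omega> ^^ i) s) ` {..<card S} = S)"

definition rotational :: "('a, 'm) monoid_scheme \<Rightarrow> 'a set \<Rightarrow> bool" where
  "rotational G S \<longleftrightarrow> (\<exists>\<omega>. complete_rotation G S \<omega>)"

subsection \<open>Frobenius groups\<close>

definition transitive_perms :: "'a set \<Rightarrow> ('a \<Rightarrow> 'a) set \<Rightarrow> bool" where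
  "transitive_perms E P \<longleftrightarrow> (\<forall>x \<in> E. \<forall>y \<in> E. \<exists>g \<in> P. g x = y)"

definition regular_perms :: "'a set \<Rightarrow> ('a \<Rightarrow> 'a) set \<Rightarrow> bool" where
  "regular_perms E P \<longleftrightarrow>
     transitive_perms E P \<and> (\<forall>g \<in> P. \<forall>x \<in> E. g x = x \<longrightarrow> g = \<one>\<^bsub>BijGroup E\<^esub>)"

definition frobenius_perm_group :: "'a set \<Rightarrow> ('a \<Rightarrow> 'a) set \<Rightarrow> bool" where
  "frobenius_perm_group E P \<longleftrightarrow>
     subgroup P (BijGroup E) \<and> transitive_perms E P \<and> \<not> regular_perms E P \<and>
     (\<forall>g \<in> P. \<forall>x \<in> E. \<forall>y \<in> E. x \<noteq> y \<and> g x = x \<and> g y = y \<longrightarrow> g = \<one>\<^bsub>BijGroup E\<^esub>)"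

subsection \<open>The group of integers modulo n and its affine groups\<close>

text \<open>For \<open>n \<ge> 2\<close> both groups consist of the representatives in \<open>{0..<n}\<close>; the class of an
  integer \<open>h\<close> is \<open>h mod int n\<close>.\<close>

abbreviation Zn :: "nat \<Rightarrow> int monoid" where
  "Zn n \<equiv> integer_mod_group n"

abbreviation Zn_units :: "nat \<Rightarrow> int monoid" where
  "Zn_units n \<equiv> units_of (residue_ring (int n))"

abbreviation cyclic_units :: "nat \<Rightarrow> int \<Rightarrow> int set" where
  "cyclic_units n h \<equiv> generate (Zn_units n) {h mod int n}"

definition unit_aut :: "nat \<Rightarrow> int \<Rightarrow> int \<Rightarrow> int" where
  "unit_aut n h = (\<lambda>x \<in> carrier (Zn n). (h * x) mod int n)"

text \<open>The semidirect product of \<open>Zn n\<close> with a group \<open>H\<close> of units acts faithfully on \<open>Zn n\<close>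
  (the images of 0 and 1 determine the unit and the translation), so it is identified
  with the permutation group it induces. The action is on the right, but this does not affect
  the set of permutations obtained.\<close>

definition semidirect_perms :: "nat \<Rightarrow> int set \<Rightarrow> (int \<Rightarrow> int) set" where
  "semidirect_perms n H =
     (\<lambda>(y, u). \<lambda>x \<in> carrier (Zn n). ((x + y) * u) mod int n) ` (carrier (Zn n) \<times> H)"

definition unit_orbit :: "nat \<Rightarrow> int \<Rightarrow> int set \<Rightarrow> int set" where
  "unit_orbit n a H = (\<lambda>u. (a * u) mod int n) ` H"

subsection \<open>First-kind Frobenius circulants\<close>

definition first_kind_frobenius :: "nat \<Rightarrow> int set \<Rightarrow> int set \<Rightarrow> bool" where
  "first_kind_frobenius n H S \<longleftrightarrow>
     subgroup H (Zn_units n) \<and>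
     frobenius_perm_group (carrier (Zn n)) (semidirect_perms n H) \<and>
     connection_set (Zn n) S \<and>
     Digraph_Component.connected (with_proj (cayley_graph (Zn n) S)) \<and>
     (\<exists>a \<in> carrier (Zn n).
        S = unit_orbit n a H \<and> generate (Zn n) (unit_orbit n a H) = carrier (Zn n) \<and>
        (even (card H) \<or> (a \<noteq> \<one>\<^bsub>Zn n\<^esub> \<and> a \<otimes>\<^bsub>Zn n\<^esub> a = \<one>\<^bsub>Zn n\<^esub>)))"

definition first_kind_frobenius_cyclic :: "nat \<Rightarrow> nat \<Rightarrow> int set \<Rightarrow> bool" where
  "first_kind_frobenius_cyclic n d S \<longleftrightarrow>
     (\<exists>H. first_kind_frobenius n H S \<and>
          cyclic_group (subgroup_generated (Zn_units n) H) \<and> card H = d)"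

definition rotational_frobenius_circulant :: "nat \<Rightarrow> nat \<Rightarrow> int set \<Rightarrow> bool" where
  "rotational_frobenius_circulant n d S \<longleftrightarrow>
     (\<exists>H. first_kind_frobenius n H S) \<and> rotational (Zn n) S \<and>
     has_degree (cayley_graph (Zn n) S) d"

definition rotational_frobenius_circulants :: "nat \<Rightarrow> nat \<Rightarrow> int pair_pre_digraph set" where
  "rotational_frobenius_circulants n d =
     cayley_graph (Zn n) ` {S. rotational_frobenius_circulant n d S}"

text \<open>The exponent \<open>m i\<close> is an integer, possibly negative, so the power of the primitive root is
  taken in the group of units modulo \<open>p i ^ e i\<close>.\<close>

definition rotation_form ::
  "nat \<Rightarrow> nat \<Rightarrow> (nat \<Rightarrow> nat) \<Rightarrow> (nat \<Rightarrow> nat) \<Rightarrow> nat \<Rightarrow> (nat \<Rightarrow> nat) \<Rightarrow> int \<Rightarrow> bool" where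
  "rotation_form n l p e d \<eta> h \<longleftrightarrow>
     (\<exists>(b :: nat \<Rightarrow> int) (c :: nat \<Rightarrow> int) (m :: nat \<Rightarrow> int).
        (\<forall>i \<in> {1..l}.
           [b i * int (n div p i ^ e i) = 1] (mod int (p i ^ e i)) \<and>
           coprime (m i) (int d) \<and>
           [c i = (int (\<eta> i) mod int (p i ^ e i)) [^]\<^bsub>Zn_units (p i ^ e i)\<^esub>
                    (m i * int (totient (p i ^ e i) div d))] (mod int (p i ^ e i))) \<and>
        h = (\<Sum>i = 1..l. int (n div p i ^ e i) * b i * c i))"

end

(*
  A rotational first-kind Frobenius circulant is Cay(Z_n, a<g>) with a a unit and <g> a cyclic
  group of units of even order d that is semiregular on the nonzero residues, i.e. with g^i - 1
  invertible for 0 < i < d. Modulo each prime power p^e this says that g has order d and that d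
  divides p - 1, so the Chinese remainder theorem and primitive roots yield phi(d)^l such g, hence
  phi(d)^(l-1) groups <g>.

  Distinct groups H, K of units give non-isomorphic graphs by Schur's theorem on multipliers:
  if q is a prime not dividing n, then modulo q the number of walks of length q between x and y in
  Cay(Z_n, S) is 1 or 0 according to whether x - y lies in qS. As walk counts are preserved by an
  isomorphism f from Cay(Z_n, aH) to Cay(Z_n, bK), f is also an isomorphism from Cay(Z_n, maH) to
  Cay(Z_n, mbK) for every m coprime to n. Taking m in H, where maH = aH, forces mbK = bK and m in K.
*)
theory Submission
  imports Defs
begin

subsection \<open>Walk counts and multipliers\<close>

text \<open>The walk count is \<open>tuple_count n S k r\<close>: the coefficient at
  \<open>r\<close> of the k-th power of the group ring element of Z_n that sums the elements of
  \<open>S\<close>. Modulo a prime q, taking q-th powers is additive, so the q-th power is the sum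
  of the multiples q s. When q is coprime to n, the map s -> q s is injective and every coefficient
  is 0 or 1. A general multiplier m is a product of such primes, so no prime in a prescribed residue
  class is required. The reduction to prime powers works because units congruent to 1 modulo p have
  p-power order modulo p^e, whereas a divisor d of p - 1 is coprime to p: an element of order d
  modulo p^e still has order d modulo p. The complement is not assumed cyclic. A rotation is
  multiplication by a unit g, and since a single orbit fills \<open>a H\<close>, the powers of g
  exhaust \<open>H\<close>. The case of an involution a cannot occur for n >= 3: a generating orbit
  makes a a unit, and 2 a = 0 would give n | 2. The exponent drops from l to l - 1 because every
  group has phi(d) generators of the required kind.\<close>

fun tuple_count :: "nat \<Rightarrow> int set \<Rightarrow> nat \<Rightarrow> int \<Rightarrow> nat" where
  "tuple_count n S 0 r = of_bool (int n dvd r)"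
| "tuple_count n S (Suc k) r = (\<Sum>t\<in>S. tuple_count n S k (r - t))"

lemma tuple_count_cong:
  "[r = r'] (mod int n) \<Longrightarrow> tuple_count n S k r = tuple_count n S k r'"
proof (induction k arbitrary: r r')
  case 0
  then show ?case by (simp add: cong_dvd_iff)
next
  case (Suc k)
  then show ?case
    by (auto intro!: sum.cong Suc.IH cong_diff cong_refl)
qed

text \<open>The binomial theorem in the group ring: \<open>j\<close> counts the entries taken from
  \<open>S\<close>, and the other \<open>k - j\<close> entries equal \<open>s\<close>. Adding one
  element at a time spares the multinomial expansion.\<close>

lemma tuple_count_insert:
  assumes "finite S" "s \<notin> S"
  shows "tuple_count n (insert s S) k r =
    (\<Sum>j\<le>k. (k choose j) * tuple_count n S j (r - int (k - j) * s))"
proof (induction k arbitrary: r)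
  case 0
  then show ?case by simp
next
  case (Suc k)
  let ?N = "tuple_count n S"
  have *: "(\<Sum>t\<in>S. ?N j (r - t - c)) = ?N (Suc j) (r - c)" for j c
    by (simp add: algebra_simps)
  have "tuple_count n (insert s S) (Suc k) r =
      (\<Sum>t\<in>S. \<Sum>j\<le>k. (k choose j) * ?N j (r - t - int (k - j) * s)) +
      (\<Sum>j\<le>k. (k choose j) * ?N j (r - s - int (k - j) * s))"
    using assms by (simp add: Suc.IH)
  also have "(\<Sum>t\<in>S. \<Sum>j\<le>k. (k choose j) * ?N j (r - t - int (k - j) * s)) =
      (\<Sum>j\<le>k. (k choose j) * ?N (Suc j) (r - int (k - j) * s))"
    by (subst sum.swap) (simp only: * flip: sum_distrib_left)
  \<comment> \<open>The index is shifted so that both sums carry the same factor \<open>?N j\<close>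
    and Pascal's rule applies termwise.\<close>
  also have "\<dots> = (\<Sum>j\<in>{1..Suc k}. (k choose (j - 1)) * ?N j (r - int (Suc k - j) * s))"
    by (rule sum.reindex_bij_witness[of _ "\<lambda>j. j - 1" Suc]) auto
  also have "(\<Sum>j\<le>k. (k choose j) * ?N j (r - s - int (k - j) * s)) =
      (\<Sum>j\<le>Suc k. (k choose j) * ?N j (r - int (Suc k - j) * s))"
    unfolding sum.atMost_Suc by (auto intro!: sum.cong simp: algebra_simps of_nat_diff)
  \<comment> \<open>Padding with \<open>j = 0\<close> needs an explicit zero: \<open>j - 1\<close>
    truncates to 0 there and the binomial coefficient would be 1.\<close>
  also have "(\<Sum>j\<in>{1..Suc k}. (k choose (j - 1)) * ?N j (r - int (Suc k - j) * s)) =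
      (\<Sum>j\<le>Suc k. (if j = 0 then 0 else k choose (j - 1)) * ?N j (r - int (Suc k - j) * s))"
    by (rule sum.mono_neutral_cong_left) auto
  also have "\<dots> + (\<Sum>j\<le>Suc k. (k choose j) * ?N j (r - int (Suc k - j) * s)) =
      (\<Sum>j\<le>Suc k. (Suc k choose j) * ?N j (r - int (Suc k - j) * s))"
    unfolding sum.distrib[symmetric]
  proof (intro sum.cong refl)
    fix j
    show "(if j = 0 then 0 else k choose (j - 1)) * ?N j (r - int (Suc k - j) * s) +
        (k choose j) * ?N j (r - int (Suc k - j) * s) =
        (Suc k choose j) * ?N j (r - int (Suc k - j) * s)"
      by (cases j) (simp_all add: distrib_right)
  qed
  finally show ?case .
qed

text \<open>The additivity of q-th powers in characteristic q, obtained by induction on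
  \<open>S\<close>: for \<open>0 < j < q\<close> the binomial coefficient in the expansion is
  divisible by \<open>q\<close>, and only the two end terms survive.\<close>

lemma tuple_count_prime_cong:
  assumes "prime q" "finite S"
  shows "[tuple_count n S q r = card {s \<in> S. int n dvd r - int q * s}] (mod q)"
  using assms(2)
proof (induction S arbitrary: r rule: finite_induct)
  case empty
  then show ?case using prime_gt_0_nat[OF assms(1)] by (cases q) auto
next
  case (insert s S)
  let ?f = "\<lambda>j. (q choose j) * tuple_count n S j (r - int (q - j) * s)"
  have q: "q > 0" using prime_gt_0_nat[OF assms(1)] .
  have "[(\<Sum>j\<le>q. ?f j) = (\<Sum>j\<le>q. if j \<in> {0, q} then ?f j else 0)] (mod q)"
    using assms(1) by (intro cong_sum) (auto simp: cong_0_iff intro!: dvd_mult2 dvd_choose_prime)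
  also have "(\<Sum>j\<le>q. if j \<in> {0, q} then ?f j else 0) = (\<Sum>j\<in>{0, q}. ?f j)"
    by (intro sum.mono_neutral_cong_right) auto
  \<comment> \<open>The end \<open>j = 0\<close> is the constant tuple with all entries
    \<open>s\<close>; the end \<open>j = q\<close> avoids \<open>s\<close> altogether.\<close>
  also have "\<dots> = of_bool (int n dvd r - int q * s) + tuple_count n S q r"
    using q by simp
  also have "[\<dots> = of_bool (int n dvd r - int q * s) + card {s \<in> S. int n dvd r - int q * s}] (mod q)"
    by (intro cong_add cong_refl insert.IH)
  also have "of_bool (int n dvd r - int q * s) + card {s \<in> S. int n dvd r - int q * s} =
      card {t \<in> insert s S. int n dvd r - int q * t}"
  proof (cases "int n dvd r - int q * s")
    case True
    then have "{t \<in> insert s S. int n dvd r - int q * t} = insert s {t \<in> S. int n dvd r - int q * t}"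
      by auto
    then show ?thesis using True insert.hyps by simp
  next
    case False
    then have "{t \<in> insert s S. int n dvd r - int q * t} = {t \<in> S. int n dvd r - int q * t}"
      by auto
    then show ?thesis using False by simp
  qed
  finally show ?case
    using insert.hyps by (simp add: tuple_count_insert)
qed

text \<open>An isomorphism between the Cayley graphs of \<open>S\<close> and \<open>T\<close>,
  phrased on residues so that one fixed \<open>f\<close> can be tested against changing pairs of
  connection sets.\<close>

definition difference_iso :: "nat \<Rightarrow> (int \<Rightarrow> int) \<Rightarrow> int set \<Rightarrow> int set \<Rightarrow> bool" where
  "difference_iso n f S T \<longleftrightarrow> bij_betw f {0..<int n} {0..<int n} \<and>
     (\<forall>x \<in> {0..<int n}. \<forall>y \<in> {0..<int n}.
        (x - y) mod int n \<in> S \<longleftrightarrow> (f x - f y) mod int n \<in> T)"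

text \<open>The substitution \<open>t = x - z\<close> turns a first summand from \<open>S\<close>
  into a first neighbour \<open>z\<close> of \<open>x\<close>. In this form the count is one of
  walks from \<open>x\<close> to \<open>y\<close> and can be carried along an isomorphism.\<close>

lemma tuple_count_Suc_eq:
  assumes "n > 0" "S \<subseteq> {0..<int n}" "x \<in> {0..<int n}"
  shows "tuple_count n S (Suc k) (x - y) =
    (\<Sum>z | z \<in> {0..<int n} \<and> (x - z) mod int n \<in> S. tuple_count n S k (z - y))"
  unfolding tuple_count.simps
proof (rule sum.reindex_bij_witness[of _ "\<lambda>z. (x - z) mod int n" "\<lambda>t. (x - t) mod int n"])
  fix t assume t: "t \<in> S"
  show "(x - (x - t) mod int n) mod int n = t"
    using assms t by (auto simp: mod_diff_right_eq)
  then show "(x - t) mod int n \<in> {z \<in> {0..<int n}. (x - z) mod int n \<in> S}"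
    using assms t by auto
  have "[(x - t) mod int n - y = x - y - t] (mod int n)"
    by (simp add: cong_def mod_diff_left_eq algebra_simps)
  then show "tuple_count n S k ((x - t) mod int n - y) = tuple_count n S k (x - y - t)"
    by (rule tuple_count_cong)
next
  fix z assume "z \<in> {z \<in> {0..<int n}. (x - z) mod int n \<in> S}"
  then show "(x - (x - z) mod int n) mod int n = z" "(x - z) mod int n \<in> S"
    by (auto simp: mod_diff_right_eq)
qed

lemma difference_iso_tuple_count:
  assumes "difference_iso n f S T" "n > 0" "S \<subseteq> {0..<int n}" "T \<subseteq> {0..<int n}"
    and "x \<in> {0..<int n}" "y \<in> {0..<int n}"
  shows "tuple_count n S k (x - y) = tuple_count n T k (f x - f y)"
  using assms(5)
proof (induction k arbitrary: x)
  case 0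
  have f: "bij_betw f {0..<int n} {0..<int n}"
    using assms(1) by (simp add: difference_iso_def)
  have eq: "int n dvd u - v \<longleftrightarrow> u = v" if "u \<in> {0..<int n}" "v \<in> {0..<int n}" for u v
    using that by (auto simp flip: mod_eq_dvd_iff)
  have "f x \<in> {0..<int n}" "f y \<in> {0..<int n}"
    using f 0 assms(6) by (auto dest: bij_betwE simp del: atLeastLessThan_iff)
  moreover have "f x = f y \<longleftrightarrow> x = y"
    using f 0 assms(6) by (auto simp: bij_betw_def dest: inj_onD)
  ultimately show ?case
    using 0 assms(6) by (simp add: eq del: atLeastLessThan_iff)
next
  case (Suc k)
  have f: "bij_betw f {0..<int n} {0..<int n}"
    using assms(1) by (simp add: difference_iso_def)
  have fx: "f x \<in> {0..<int n}"
    using f Suc.prems by (auto dest: bij_betwE simp del: atLeastLessThan_iff)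
  \<comment> \<open>\<open>f\<close> matches the neighbours of \<open>x\<close> with those of
    \<open>f x\<close>, so the sums over the first step of a walk correspond.\<close>
  have bij: "bij_betw f {z \<in> {0..<int n}. (x - z) mod int n \<in> S}
      {z \<in> {0..<int n}. (f x - z) mod int n \<in> T}"
  proof (rule bij_betw_subset[OF f])
    show "{z \<in> {0..<int n}. (x - z) mod int n \<in> S} \<subseteq> {0..<int n}" by auto
    show "f ` {z \<in> {0..<int n}. (x - z) mod int n \<in> S} = {z \<in> {0..<int n}. (f x - z) mod int n \<in> T}"
    proof (intro equalityI subsetI)
      fix w assume "w \<in> f ` {z \<in> {0..<int n}. (x - z) mod int n \<in> S}"
      then show "w \<in> {z \<in> {0..<int n}. (f x - z) mod int n \<in> T}"
        using assms(1) Suc.prems bij_betwE[OF f] unfolding difference_iso_def by blast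
    next
      fix w assume w: "w \<in> {z \<in> {0..<int n}. (f x - z) mod int n \<in> T}"
      then obtain z where "z \<in> {0..<int n}" "w = f z"
        using f unfolding bij_betw_def by blast
      then show "w \<in> f ` {z \<in> {0..<int n}. (x - z) mod int n \<in> S}"
        using w assms(1) Suc.prems unfolding difference_iso_def by blast
    qed
  qed
  have "tuple_count n S (Suc k) (x - y) =
      (\<Sum>z | z \<in> {0..<int n} \<and> (x - z) mod int n \<in> S. tuple_count n T k (f z - f y))"
    unfolding tuple_count_Suc_eq[OF assms(2,3) Suc.prems]
    by (intro sum.cong) (auto simp: Suc.IH)
  also have "\<dots> = (\<Sum>z | z \<in> {0..<int n} \<and> (f x - z) mod int n \<in> T. tuple_count n T k (z - f y))"
    by (rule sum.reindex_bij_betw[OF bij])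
  also have "\<dots> = tuple_count n T (Suc k) (f x - f y)"
    by (rule tuple_count_Suc_eq[OF assms(2,4) fx, symmetric])
  finally show ?case .
qed

lemma unit_orbit_unit_orbit:
  "unit_orbit n a (unit_orbit n b S) = unit_orbit n (a * b) S"
  by (auto simp: unit_orbit_def image_image mod_mult_right_eq mult.assoc)

lemma unit_orbit_subset: "n > 0 \<Longrightarrow> unit_orbit n a S \<subseteq> {0..<int n}"
  by (auto simp: unit_orbit_def)

lemma tuple_count_prime_coprime:
  assumes "prime q" "coprime q n" "n > 0" "S \<subseteq> {0..<int n}"
  shows "[tuple_count n S q r = of_bool (r mod int n \<in> unit_orbit n (int q) S)] (mod q)"
proof -
  have fin: "finite S" using assms(4) by (rule finite_subset) simp
  \<comment> \<open>Multiplication by \<open>q\<close> is injective modulo \<open>n\<close>, so at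
    most one \<open>s\<close> solves \<open>q s = r\<close>; the cardinality is 0 or 1.\<close>
  have unique: "s = t" if "s \<in> S" "t \<in> S" "int n dvd r - int q * s" "int n dvd r - int q * t" for s t
  proof -
    have "int n dvd (r - int q * s) - (r - int q * t)" by (rule dvd_diff[OF that(3,4)])
    then have "int n dvd int q * (t - s)" by (simp add: algebra_simps)
    then have "int n dvd t - s"
      using assms(2) by (subst (asm) coprime_dvd_mult_right_iff) (auto simp: coprime_commute)
    moreover have "s \<in> {0..<int n}" "t \<in> {0..<int n}" using that assms(4) by auto
    ultimately show ?thesis by (auto simp flip: mod_eq_dvd_iff)
  qed
  have "card {s \<in> S. int n dvd r - int q * s} = of_bool (r mod int n \<in> unit_orbit n (int q) S)"
  proof (cases "r mod int n \<in> unit_orbit n (int q) S")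
    case True
    then obtain s where s: "s \<in> S" "int n dvd r - int q * s"
      by (auto simp: unit_orbit_def mod_eq_dvd_iff)
    then have "{s \<in> S. int n dvd r - int q * s} = {s}" using unique by blast
    then have "card {s \<in> S. int n dvd r - int q * s} = 1" by (simp only: card_1_singleton_iff) auto
    then show ?thesis using True by (simp only: of_bool_def if_True)
  next
    case False
    then have "{s \<in> S. int n dvd r - int q * s} = {}"
      by (auto simp: unit_orbit_def mod_eq_dvd_iff)
    then show ?thesis using False by (simp only: card.empty of_bool_def if_False)
  qed
  then show ?thesis using tuple_count_prime_cong[OF assms(1) fin, of n r] by simp
qed

lemma of_bool_cong_nat_iff:
  fixes q :: nat
  assumes "q > 1"
  shows "[of_bool P = of_bool Q] (mod q) \<longleftrightarrow> P = Q"
  using assms by (cases P; cases Q) (simp_all add: cong_def)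

text \<open>\<open>f\<close> preserves walk counts of length \<open>q\<close>; as 0 and 1 differ
  modulo \<open>q\<close>, these counts modulo \<open>q\<close> reveal membership in the multiplied
  connection sets.\<close>

lemma difference_iso_prime_multiple:
  assumes "difference_iso n f S T" "prime q" "coprime q n" "n > 0"
    and "S \<subseteq> {0..<int n}" "T \<subseteq> {0..<int n}"
  shows "difference_iso n f (unit_orbit n (int q) S) (unit_orbit n (int q) T)"
  unfolding difference_iso_def
proof (intro conjI ballI)
  show "bij_betw f {0..<int n} {0..<int n}" using assms(1) by (simp add: difference_iso_def)
  fix x y assume xy: "x \<in> {0..<int n}" "y \<in> {0..<int n}"
  have "[of_bool ((x - y) mod int n \<in> unit_orbit n (int q) S) = tuple_count n S q (x - y)] (mod q)"
    by (rule cong_sym[OF tuple_count_prime_coprime[OF assms(2-5)]])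
  also have "tuple_count n S q (x - y) = tuple_count n T q (f x - f y)"
    by (rule difference_iso_tuple_count[OF assms(1,4-6) xy])
  also have "[\<dots> = of_bool ((f x - f y) mod int n \<in> unit_orbit n (int q) T)] (mod q)"
    by (rule tuple_count_prime_coprime[OF assms(2-4,6)])
  finally have "[of_bool ((x - y) mod int n \<in> unit_orbit n (int q) S) =
      of_bool ((f x - f y) mod int n \<in> unit_orbit n (int q) T)] (mod q)" .
  then show "(x - y) mod int n \<in> unit_orbit n (int q) S \<longleftrightarrow>
      (f x - f y) mod int n \<in> unit_orbit n (int q) T"
    by (rule of_bool_cong_nat_iff[OF prime_gt_1_nat[OF assms(2)], THEN iffD1])
qed

text \<open>The multiplier is built up one prime factor at a time. Each factor is again coprime to
  \<open>n\<close>, and \<open>f\<close> never changes.\<close>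

lemma difference_iso_coprime_multiple:
  assumes "difference_iso n f S T" "m > 0" "coprime m n" "n > 0"
    and "S \<subseteq> {0..<int n}" "T \<subseteq> {0..<int n}"
  shows "difference_iso n f (unit_orbit n (int m) S) (unit_orbit n (int m) T)"
  using assms(2,3)
proof (induction m rule: prime_divisors_induct)
  case zero
  then show ?case by simp
next
  case (unit x)
  have "unit_orbit n 1 S = S" if "S \<subseteq> {0..<int n}" for S
    using that by (force simp: unit_orbit_def image_iff)
  then show ?case using unit assms by simp
next
  case (factor p x)
  then have "difference_iso n f (unit_orbit n (int x) S) (unit_orbit n (int x) T)" by auto
  then have "difference_iso n f (unit_orbit n (int p) (unit_orbit n (int x) S))
      (unit_orbit n (int p) (unit_orbit n (int x) T))"
    using factor by (intro difference_iso_prime_multiple[OF _ factor(1) _ assms(4)] unit_orbit_subset assms(4)) auto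
  then show ?case by (simp add: unit_orbit_unit_orbit)
qed

text \<open>\<open>f\<close> is onto, so every residue is a difference \<open>f x - f 0\<close>, and
  its membership in the target set is dictated by \<open>S\<close>.\<close>

lemma difference_iso_right_unique:
  assumes "difference_iso n f S T" "difference_iso n f S T'" "n > 0"
    and "T \<subseteq> {0..<int n}" "T' \<subseteq> {0..<int n}"
  shows "T = T'"
proof -
  have "t \<in> T \<longleftrightarrow> t \<in> T'" if t: "t \<in> {0..<int n}" for t
  proof -
    have f: "bij_betw f {0..<int n} {0..<int n}" using assms(1) by (simp add: difference_iso_def)
    have "(t + f 0) mod int n \<in> {0..<int n}" using assms(3) by simp
    then obtain x where x: "x \<in> {0..<int n}" "f x = (t + f 0) mod int n"
      using f unfolding bij_betw_def by (metis imageE)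
    have "(f x - f 0) mod int n = t" using t by (simp add: x(2) mod_diff_left_eq)
    moreover have "0 \<in> {0..<int n}" using assms(3) by simp
    ultimately show ?thesis
      using assms(1,2) x(1) unfolding difference_iso_def by blast
  qed
  then show ?thesis using assms(4,5) by blast
qed

section \<open>Graph isomorphisms as bijections of residues\<close>

text \<open>An isomorphism of digraphs carries a separate map on arcs and names the new head and
  tail functions. In a pair digraph these must be the two projections, so the vertex map determines
  the rest.\<close>

lemma isomorphic_graphs_iff:
  assumes "parcs \<Gamma> \<subseteq> pverts \<Gamma> \<times> pverts \<Gamma>" "parcs \<Delta> \<subseteq> pverts \<Delta> \<times> pverts \<Delta>"
  shows "isomorphic_graphs \<Gamma> \<Delta> \<longleftrightarrow> (\<exists>f. bij_betw f (pverts \<Gamma>) (pverts \<Delta>) \<and>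
    (\<forall>x \<in> pverts \<Gamma>. \<forall>y \<in> pverts \<Gamma>. (x, y) \<in> parcs \<Gamma> \<longleftrightarrow> (f x, f y) \<in> parcs \<Delta>))" (is "_ \<longleftrightarrow> ?R")
proof
  assume "isomorphic_graphs \<Gamma> \<Delta>"
  then obtain h where h: "pre_digraph.digraph_isomorphism (with_proj \<Gamma>) h"
    and eq: "with_proj \<Delta> = app_iso h (with_proj \<Gamma>)"
    unfolding isomorphic_graphs_def digraph_iso_def by blast
  let ?f = "iso_verts h"
  have inj: "inj_on ?f (pverts \<Gamma>)" and ia: "inj_on (iso_arcs h) (parcs \<Gamma>)"
    and ends: "\<And>a. a \<in> parcs \<Gamma> \<Longrightarrow> ?f (fst a) = iso_tail h (iso_arcs h a)"
      "\<And>a. a \<in> parcs \<Gamma> \<Longrightarrow> ?f (snd a) = iso_head h (iso_arcs h a)"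
    using h unfolding pre_digraph.digraph_isomorphism_def by (auto simp: with_proj_def)
  have img: "pverts \<Delta> = ?f ` pverts \<Gamma>" "parcs \<Delta> = iso_arcs h ` parcs \<Gamma>"
    and proj: "iso_tail h = fst" "iso_head h = snd"
    using eq by (auto simp: with_proj_def app_iso_def)
  \<comment> \<open>Compatibility with the projections leaves only one possible value for the arc
    map.\<close>
  have arc: "iso_arcs h a = (?f (fst a), ?f (snd a))" if "a \<in> parcs \<Gamma>" for a
    using ends[OF that] proj by (simp add: prod_eq_iff)
  have "(x, y) \<in> parcs \<Gamma> \<longleftrightarrow> (?f x, ?f y) \<in> parcs \<Delta>" if "x \<in> pverts \<Gamma>" "y \<in> pverts \<Gamma>" for x y
  proof
    show "(x, y) \<in> parcs \<Gamma> \<Longrightarrow> (?f x, ?f y) \<in> parcs \<Delta>"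
      using img(2) arc by force
    assume "(?f x, ?f y) \<in> parcs \<Delta>"
    then obtain a where a: "a \<in> parcs \<Gamma>" "(?f x, ?f y) = iso_arcs h a" using img(2) by auto
    then have "?f x = ?f (fst a)" "?f y = ?f (snd a)" using arc by auto
    moreover have "fst a \<in> pverts \<Gamma>" "snd a \<in> pverts \<Gamma>" using a assms(1) by auto
    ultimately have "x = fst a" "y = snd a" using inj that by (auto dest: inj_onD)
    then show "(x, y) \<in> parcs \<Gamma>" using a by simp
  qed
  then show ?R using inj img(1) by (intro exI[of _ ?f]) (auto simp: bij_betw_def)
next
  assume ?R
  then obtain f where f: "bij_betw f (pverts \<Gamma>) (pverts \<Delta>)"
    and arcs: "\<And>x y. x \<in> pverts \<Gamma> \<Longrightarrow> y \<in> pverts \<Gamma> \<Longrightarrow> (x, y) \<in> parcs \<Gamma> \<longleftrightarrow> (f x, f y) \<in> parcs \<Delta>"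
    by blast
  let ?h = "\<lparr>iso_verts = f, iso_arcs = map_prod f f, iso_head = snd, iso_tail = fst\<rparr>"
  have inj: "inj_on f (pverts \<Gamma>)" and img: "f ` pverts \<Gamma> = pverts \<Delta>"
    using f by (auto simp: bij_betw_def)
  have "inj_on (map_prod f f) (parcs \<Gamma>)"
    using map_prod_inj_on[OF inj inj] assms(1) by (rule inj_on_subset)
  moreover have "wf_digraph (with_proj \<Gamma>)"
    using assms(1) by unfold_locales (auto simp: with_proj_def)
  ultimately have "pre_digraph.digraph_isomorphism (with_proj \<Gamma>) ?h"
    using inj by (auto simp: pre_digraph.digraph_isomorphism_def with_proj_def)
  moreover have "map_prod f f ` parcs \<Gamma> = parcs \<Delta>"
  proof (intro equalityI subsetI)
    fix b assume "b \<in> map_prod f f ` parcs \<Gamma>"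
    then show "b \<in> parcs \<Delta>" using arcs assms(1) by fastforce
  next
    fix b assume b: "b \<in> parcs \<Delta>"
    then obtain u v where uv: "b = (f u, f v)" "u \<in> pverts \<Gamma>" "v \<in> pverts \<Gamma>"
      using assms(2) img by (cases b) blast
    then show "b \<in> map_prod f f ` parcs \<Gamma>" using arcs b by force
  qed
  then have "with_proj \<Delta> = app_iso ?h (with_proj \<Gamma>)"
    using img by (simp add: with_proj_def app_iso_def)
  ultimately show "isomorphic_graphs \<Gamma> \<Delta>"
    unfolding isomorphic_graphs_def digraph_iso_def by blast
qed

lemma carrier_Zn: "n > 0 \<Longrightarrow> carrier (Zn n) = {0..<int n}"
  by (simp add: carrier_integer_mod_group)

lemma cayley_graph_Zn:
  assumes "n > 0"
  shows "cayley_graph (Zn n) S = \<lparr>pverts = {0..<int n},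
    parcs = {(x, y). x \<in> {0..<int n} \<and> y \<in> {0..<int n} \<and> (x - y) mod int n \<in> S}\<rparr>"
  using assms
  by (auto simp: cayley_graph_def carrier_Zn mod_add_right_eq inv_integer_mod_group)

lemma isomorphic_cayley_graphs_iff:
  assumes "n > 0"
  shows "isomorphic_graphs (cayley_graph (Zn n) S) (cayley_graph (Zn n) T) \<longleftrightarrow>
    (\<exists>f. difference_iso n f S T)"
proof -
  have "isomorphic_graphs (cayley_graph (Zn n) S) (cayley_graph (Zn n) T) \<longleftrightarrow>
      (\<exists>f. bij_betw f {0..<int n} {0..<int n} \<and>
        (\<forall>x \<in> {0..<int n}. \<forall>y \<in> {0..<int n}.
          (x, y) \<in> parcs (cayley_graph (Zn n) S) \<longleftrightarrow> (f x, f y) \<in> parcs (cayley_graph (Zn n) T)))"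
    by (subst isomorphic_graphs_iff) (use assms in \<open>auto simp: cayley_graph_Zn\<close>)
  also have "\<dots> \<longleftrightarrow> (\<exists>f. difference_iso n f S T)"
    unfolding difference_iso_def using assms
    by (intro ex_cong1 conj_cong refl ball_cong) (auto simp: cayley_graph_Zn dest: bij_betwE)
  finally show ?thesis .
qed

subsection \<open>Semiregular cyclic groups of units\<close>

lemma residues_nat: "n > 1 \<Longrightarrow> residues (int n)"
  by (simp add: residues_def)

lemma carrier_Zn_units:
  assumes "n > 1"
  shows "carrier (Zn_units n) = {x \<in> {0..<int n}. coprime x (int n)}"
proof -
  have "carrier (Zn_units n) = {x. 0 < x \<and> x < int n \<and> coprime x (int n)}"
    using residues.res_units_eq[OF residues_nat[OF assms]] by (simp add: units_of_carrier)
  moreover have "0 < x \<longleftrightarrow> 0 \<le> x" if "coprime x (int n)" for x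
    using that assms by (cases "x = 0") auto
  ultimately show ?thesis by auto
qed

lemma group_Zn_units: "n > 1 \<Longrightarrow> group (Zn_units n)"
  using residues.cring[OF residues_nat] by (simp add: cring_def ring_def monoid.units_group)

lemma mult_Zn_units: "n > 1 \<Longrightarrow> x \<otimes>\<^bsub>Zn_units n\<^esub> y = (x * y) mod int n"
  by (simp add: units_of_mult residues.res_mult_eq residues_nat)

lemma one_Zn_units: "n > 1 \<Longrightarrow> \<one>\<^bsub>Zn_units n\<^esub> = 1"
  by (simp add: units_of_one residues.res_one_eq residues_nat)

lemma pow_Zn_units:
  assumes "n > 1"
  shows "(x mod int n) [^]\<^bsub>Zn_units n\<^esub> (k :: nat) = x ^ k mod int n"
proof -
  interpret group "Zn_units n" by (rule group_Zn_units[OF assms])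
  show ?thesis
  proof (induction k)
    case 0
    then show ?case using assms by (simp add: one_Zn_units)
  next
    case (Suc k)
    have "(x mod int n) [^]\<^bsub>Zn_units n\<^esub> Suc k = ((x ^ k mod int n) * (x mod int n)) mod int n"
      using assms by (simp only: nat_pow_Suc Suc.IH mult_Zn_units)
    also have "\<dots> = x ^ Suc k mod int n"
      by (simp only: mod_mult_eq power_Suc2)
    finally show ?case .
  qed
qed


lemma finite_Zn_units: "n > 1 \<Longrightarrow> finite (carrier (Zn_units n))"
  by (rule finite_subset[of _ "{0..<int n}"]) (auto simp: carrier_Zn_units)

lemma mod_in_Zn_units: "n > 1 \<Longrightarrow> coprime g (int n) \<Longrightarrow> g mod int n \<in> carrier (Zn_units n)"
  by (simp add: carrier_Zn_units)

lemma cyclic_units_eq: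
  assumes "n > 1" "coprime g (int n)"
  shows "cyclic_units n g = range (\<lambda>i :: nat. g ^ i mod int n)"
proof -
  interpret group "Zn_units n" by (rule group_Zn_units[OF assms(1)])
  have "cyclic_units n g = {(g mod int n) [^]\<^bsub>Zn_units n\<^esub> k |k. k \<in> (UNIV :: nat set)}"
    using assms by (intro generate_pow_on_finite_carrier finite_Zn_units mod_in_Zn_units)
  then show ?thesis using assms(1) by (auto simp: pow_Zn_units)
qed

lemma subgroup_cyclic_units:
  assumes "n > 1" "coprime g (int n)"
  shows "subgroup (cyclic_units n g) (Zn_units n)"
  using assms mod_in_Zn_units by (intro group.generate_is_subgroup group_Zn_units) auto

text \<open>A unit \<open>u\<close> fixes a nonzero residue z exactly when \<open>n\<close> divides
  \<open>(u - 1) * z\<close>, so the absence of such fixed points means that \<open>u - 1\<close> is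
  a unit. This is the condition imposed on the nontrivial powers of \<open>g\<close>. Keeping
  \<open>g\<close> an arbitrary integer lets it be reduced modulo each prime power.\<close>

definition semiregular_root :: "nat \<Rightarrow> nat \<Rightarrow> int \<Rightarrow> bool" where
  "semiregular_root n d g \<longleftrightarrow> d > 0 \<and> [g ^ d = 1] (mod int n) \<and>
     (\<forall>i. 0 < i \<and> i < d \<longrightarrow> coprime (g ^ i - 1) (int n))"

lemma semiregular_root_coprime:
  assumes "semiregular_root n d g"
  shows "coprime g (int n)"
proof -
  have "coprime (g ^ d) (int n)"
    using assms unfolding semiregular_root_def by (metis cong_imp_coprime cong_sym coprime_1_left)
  then show ?thesis using assms by (simp add: semiregular_root_def)
qed

lemma semiregular_root_cong:
  assumes "[g = g'] (mod int n)"
  shows "semiregular_root n d g \<longleftrightarrow> semiregular_root n d g'"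
proof -
  have "[g ^ i = g' ^ i] (mod int n)" for i using assms by (rule cong_pow)
  moreover from this have "[g ^ i - 1 = g' ^ i - 1] (mod int n)" for i by (intro cong_diff cong_refl)
  ultimately show ?thesis
    unfolding semiregular_root_def by (metis cong_sym cong_trans cong_imp_coprime)
qed

lemma semiregular_root_pow_mod:
  assumes "semiregular_root n d g"
  shows "g ^ i mod int n = g ^ (i mod d) mod int n"
proof -
  have "[(g ^ d) ^ (i div d) * g ^ (i mod d) = 1 ^ (i div d) * g ^ (i mod d)] (mod int n)"
    using assms by (intro cong_mult cong_pow cong_refl) (simp add: semiregular_root_def)
  then show ?thesis
    by (simp add: cong_def flip: power_mult power_add)
qed

text \<open>If two powers with exponents \<open>i < j\<close> agreed, \<open>n\<close> would divide
  \<open>(g ^ (j - i) - 1) * g ^ i\<close>, a product of two units.\<close>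

lemma semiregular_root_inj:
  assumes "semiregular_root n d g" "n > 1"
  shows "inj_on (\<lambda>i. g ^ i mod int n) {..<d}"
proof -
  have "i = j" if "i \<le> j" "j < d" "g ^ i mod int n = g ^ j mod int n" for i j
  proof (rule ccontr)
    assume "i \<noteq> j"
    then have cop: "coprime (int n) (g ^ (j - i) - 1)"
      using assms(1) that unfolding semiregular_root_def by (simp add: coprime_commute)
    have "int n dvd g ^ j - g ^ i"
      using that(3)[symmetric] by (simp only: mod_eq_dvd_iff)
    also have "g ^ j = g ^ (j - i) * g ^ i"
      using that(1) by (simp flip: power_add)
    also have "g ^ (j - i) * g ^ i - g ^ i = (g ^ (j - i) - 1) * g ^ i"
      by (simp add: left_diff_distrib)
    finally have "int n dvd g ^ i" using cop by (simp add: coprime_dvd_mult_right_iff)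
    moreover have "coprime (g ^ i) (int n)"
      using semiregular_root_coprime[OF assms(1)] by simp
    ultimately have "is_unit (int n)"
      using coprime_common_divisor[of "g ^ i" "int n" "int n"] by simp
    then show False using assms(2) by simp
  qed
  note le = this
  show ?thesis
  proof (rule inj_onI)
    fix i j assume "i \<in> {..<d}" "j \<in> {..<d}" "g ^ i mod int n = g ^ j mod int n"
    then show "i = j" using le[of i j] le[of j i] by (cases "i \<le> j") auto
  qed
qed

lemma semiregular_root_cyclic_units:
  assumes "semiregular_root n d g" "n > 1"
  shows "cyclic_units n g = (\<lambda>i. g ^ i mod int n) ` {..<d}"
proof -
  have "d > 0" using assms(1) by (simp add: semiregular_root_def)
  have "range (\<lambda>i. g ^ i mod int n) = (\<lambda>i. g ^ i mod int n) ` {..<d}"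
  proof (intro equalityI subsetI)
    fix x assume "x \<in> range (\<lambda>i. g ^ i mod int n)"
    then obtain i where "x = g ^ (i mod d) mod int n"
      using semiregular_root_pow_mod[OF assms(1)] by auto
    moreover have "i mod d \<in> {..<d}" using \<open>d > 0\<close> by simp
    ultimately show "x \<in> (\<lambda>i. g ^ i mod int n) ` {..<d}" by blast
  qed auto
  then show ?thesis
    using cyclic_units_eq[OF assms(2) semiregular_root_coprime[OF assms(1)]] by simp
qed

lemma card_semiregular_root:
  assumes "semiregular_root n d g" "n > 1"
  shows "card (cyclic_units n g) = d"
  using card_image[OF semiregular_root_inj[OF assms]]
  by (simp add: semiregular_root_cyclic_units[OF assms])

lemma semiregular_root_unit_diff:
  assumes "semiregular_root n d g" "n > 1" "u \<in> cyclic_units n g" "u \<noteq> 1"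
  shows "coprime (u - 1) (int n)"
proof -
  obtain i where i: "i < d" "u = g ^ i mod int n"
    using assms by (auto simp: semiregular_root_cyclic_units)
  have "i \<noteq> 0" using assms(2,4) i by (cases "i = 0") auto
  then have "coprime (g ^ i - 1) (int n)"
    using assms(1) i unfolding semiregular_root_def by simp
  moreover have "[g ^ i - 1 = u - 1] (mod int n)"
    unfolding i by (intro cong_diff cong_refl) simp
  ultimately show ?thesis using cong_imp_coprime by blast
qed

text \<open>The involution of a cyclic group of even order is a unit \<open>u\<close> with
  \<open>(u - 1) * (u + 1) = 0\<close> and \<open>u - 1\<close> invertible.\<close>

lemma semiregular_root_minus_one:
  assumes "semiregular_root n d g" "even d"
  shows "[g ^ (d div 2) = -1] (mod int n)"
proof -
  obtain k where k: "d = 2 * k" using assms(2) by (elim evenE)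
  have d: "d > 0" and dvd: "int n dvd g ^ d - 1"
    and "0 < k \<and> k < d \<longrightarrow> coprime (g ^ k - 1) (int n)"
    using assms(1) unfolding semiregular_root_def cong_iff_dvd_diff by auto
  then have cop: "coprime (int n) (g ^ k - 1)" using k by (simp add: coprime_commute)
  define y where "y = g ^ k"
  have "g ^ d - 1 = (y - 1) * (y + 1)"
    unfolding k mult.commute[of 2 k] power_mult y_def[symmetric]
    by (simp add: power2_eq_square algebra_simps)
  then have "int n dvd y + 1"
    using dvd cop unfolding y_def by (simp add: coprime_dvd_mult_right_iff)
  then show ?thesis by (simp add: k y_def cong_iff_dvd_diff)
qed

subsection \<open>Frobenius groups of affine permutations\<close>

abbreviation affine_perm :: "nat \<Rightarrow> int \<Rightarrow> int \<Rightarrow> int \<Rightarrow> int" where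
  "affine_perm n y u \<equiv> \<lambda>x \<in> {0..<int n}. ((x + y) * u) mod int n"

lemma semidirect_perms_eq:
  assumes "n > 0"
  shows "semidirect_perms n H = {affine_perm n y u |y u. y \<in> {0..<int n} \<and> u \<in> H}"
proof -
  have "(\<lambda>(y, u). F y u) ` (A \<times> B) = {F y u |y u. y \<in> A \<and> u \<in> B}"
    for F :: "int \<Rightarrow> int \<Rightarrow> int \<Rightarrow> int" and A B
    by auto
  then show ?thesis unfolding semidirect_perms_def carrier_Zn[OF assms] .
qed

lemma affine_perm_in_semidirect_perms:
  assumes "n > 0" "u \<in> H"
  shows "affine_perm n (y mod int n) u \<in> semidirect_perms n H"
  unfolding semidirect_perms_eq[OF assms(1)]
  by (rule CollectI, rule exI[of _ "y mod int n"], rule exI[of _ u]) (use assms in simp)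

lemma mod_mult_cancel_coprime:
  fixes u m x y :: int
  assumes "coprime u m" "(x * u) mod m = (y * u) mod m"
  shows "x mod m = y mod m"
  using assms cong_mult_rcancel[of u m x y] by (simp add: cong_def coprime_commute)

lemma affine_perm_Bij:
  assumes "n > 0" "coprime u (int n)"
  shows "affine_perm n y u \<in> Bij {0..<int n}"
proof -
  have "inj_on (affine_perm n y u) {0..<int n}"
  proof (rule inj_onI)
    fix x x' assume x: "x \<in> {0..<int n}" "x' \<in> {0..<int n}"
      and "affine_perm n y u x = affine_perm n y u x'"
    then have "(x + y) mod int n = (x' + y) mod int n"
      using mod_mult_cancel_coprime[OF assms(2), of "x + y" "x' + y"] by simp
    then have "[x = x'] (mod int n)"
      by (simp add: cong_def[symmetric] cong_add_rcancel)
    then show "x = x'" using x by (simp add: cong_def)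
  qed
  moreover have "affine_perm n y u ` {0..<int n} \<subseteq> {0..<int n}"
    using assms(1) by auto
  ultimately have "bij_betw (affine_perm n y u) {0..<int n} {0..<int n}"
    by (simp add: bij_betw_def endo_inj_surj)
  then show ?thesis by (simp add: Bij_def)
qed

lemma one_BijGroup: "\<one>\<^bsub>BijGroup E\<^esub> = (\<lambda>x \<in> E. x)"
  by (simp add: BijGroup_def)

lemma mult_BijGroup: "f \<in> Bij E \<Longrightarrow> g \<in> Bij E \<Longrightarrow> f \<otimes>\<^bsub>BijGroup E\<^esub> g = compose E f g"
  by (simp add: BijGroup_def)

text \<open>Each map translates before it multiplies. A translation by \<open>y\<close> that follows
  multiplication by \<open>u'\<close> therefore has to be pulled in front of it, where it becomes a
  translation by \<open>y * w\<close> with \<open>w\<close> the inverse of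
  \<open>u'\<close>.\<close>

lemma affine_perm_mult:
  assumes "n > 0" "coprime u (int n)" "coprime u' (int n)" "[u' * w = 1] (mod int n)"
  shows "affine_perm n y u \<otimes>\<^bsub>BijGroup {0..<int n}\<^esub> affine_perm n y' u' =
    affine_perm n ((y' + y * w) mod int n) ((u' * u) mod int n)"
proof -
  have "(((x + y') * u') mod int n + y) * u mod int n =
      (x + (y' + y * w) mod int n) * (u' * u mod int n) mod int n" for x
  proof -
    have "[((x + y') * u' mod int n + y) * u = ((x + y') * u' + y * 1) * u] (mod int n)"
      by (intro cong_mult cong_add cong_refl) auto
    also have "[((x + y') * u' + y * 1) * u = ((x + y') * u' + y * (u' * w)) * u] (mod int n)"
      by (intro cong_mult cong_add cong_refl cong_sym[OF assms(4)])
    also have "((x + y') * u' + y * (u' * w)) * u = (x + (y' + y * w)) * (u' * u)"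
      by (simp add: algebra_simps)
    also have "[\<dots> = (x + (y' + y * w) mod int n) * (u' * u mod int n)] (mod int n)"
      by (intro cong_mult cong_add cong_refl) auto
    finally show ?thesis by (simp add: cong_def)
  qed
  then show ?thesis
    using assms(1)
    unfolding mult_BijGroup[OF affine_perm_Bij[OF assms(1,2)] affine_perm_Bij[OF assms(1,3)]]
    by (auto simp: compose_def restrict_def)
qed

lemma subgroup_Zn_units_inverse:
  assumes "n > 1" "subgroup H (Zn_units n)" "u \<in> H"
  obtains w where "w \<in> H" "[u * w = 1] (mod int n)"
proof -
  interpret group "Zn_units n" by (rule group_Zn_units[OF assms(1)])
  have "u \<in> carrier (Zn_units n)" using assms by (meson subgroup.mem_carrier)
  then have "(u * inv\<^bsub>Zn_units n\<^esub> u) mod int n = 1"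
    using r_inv[of u] assms(1) by (simp add: mult_Zn_units one_Zn_units)
  then have "[u * inv\<^bsub>Zn_units n\<^esub> u = 1] (mod int n)" using assms(1) by (simp add: cong_def)
  then show thesis using that subgroup.m_inv_closed[OF assms(2,3)] by blast
qed

lemma subgroup_Zn_units_simps:
  assumes "n > 1" "subgroup H (Zn_units n)"
  shows "1 \<in> H" and "u \<in> H \<Longrightarrow> u \<in> {0..<int n}" and "u \<in> H \<Longrightarrow> coprime u (int n)"
    and "u \<in> H \<Longrightarrow> v \<in> H \<Longrightarrow> (u * v) mod int n \<in> H"
  using subgroup.one_closed[OF assms(2)] subgroup.mem_carrier[OF assms(2), of u]
    subgroup.m_closed[OF assms(2), of u v] assms(1)
  by (auto simp: one_Zn_units carrier_Zn_units mult_Zn_units)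

lemma subgroup_semidirect_perms:
  assumes "n > 1" "subgroup H (Zn_units n)"
  shows "subgroup (semidirect_perms n H) (BijGroup {0..<int n})"
proof -
  let ?B = "BijGroup {0..<int n}"
  note H = subgroup_Zn_units_simps[OF assms]
  have n: "n > 0" using assms(1) by simp
  interpret B: group ?B by (rule group_BijGroup)
  note memI = affine_perm_in_semidirect_perms[OF n, of _ H]
  have memE: "\<exists>y u. y \<in> {0..<int n} \<and> u \<in> H \<and> f = affine_perm n y u"
    if "f \<in> semidirect_perms n H" for f
    using that n by (auto simp: semidirect_perms_eq)
  have id: "affine_perm n 0 1 = \<one>\<^bsub>?B\<^esub>"
    by (auto simp: one_BijGroup restrict_def)
  have carr: "semidirect_perms n H \<subseteq> carrier ?B"
    using n H(3) by (auto simp: semidirect_perms_eq BijGroup_def intro!: affine_perm_Bij)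
  show ?thesis
  proof (rule B.subgroupI[OF carr])
    show "semidirect_perms n H \<noteq> {}" using memI[OF H(1)] by blast
  next
    fix f g assume "f \<in> semidirect_perms n H" "g \<in> semidirect_perms n H"
    then obtain y u y' u' where f: "u \<in> H" "f = affine_perm n y u" and g: "u' \<in> H" "g = affine_perm n y' u'"
      using memE by meson
    obtain w where "w \<in> H" "[u' * w = 1] (mod int n)"
      using subgroup_Zn_units_inverse[OF assms g(1)] .
    then show "f \<otimes>\<^bsub>?B\<^esub> g \<in> semidirect_perms n H"
      using f g n H(3) memI[OF H(4)] by (simp add: affine_perm_mult)
  next
    fix f assume fP: "f \<in> semidirect_perms n H"
    then obtain y u where f: "u \<in> H" "f = affine_perm n y u" using memE by meson
    obtain w where w: "w \<in> H" "[u * w = 1] (mod int n)"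
      using subgroup_Zn_units_inverse[OF assms f(1)] .
    \<comment> \<open>Solving \<open>(x + y) * u = t\<close> for \<open>x\<close> gives
      \<open>t * w - y\<close>, which equals \<open>(t - y * u) * w\<close>.\<close>
    let ?g = "affine_perm n ((- (y * u)) mod int n) w"
    have "?g \<otimes>\<^bsub>?B\<^esub> f = affine_perm n ((y + ((- (y * u)) mod int n) * w) mod int n) ((u * w) mod int n)"
      unfolding f(2) by (rule affine_perm_mult[OF n H(3)[OF w(1)] H(3)[OF f(1)] w(2)])
    moreover have "(u * w) mod int n = 1" using w(2) assms(1) by (simp add: cong_def)
    moreover have "[y + ((- (y * u)) mod int n) * w = y + (- (y * u)) * w] (mod int n)"
      by (intro cong_add cong_mult cong_refl) auto
    then have "[y + ((- (y * u)) mod int n) * w = y - y * (u * w)] (mod int n)"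
      by (simp add: mult.assoc)
    then have "[y + ((- (y * u)) mod int n) * w = y - y * 1] (mod int n)"
      by (rule cong_trans) (intro cong_diff cong_mult cong_refl w(2))
    then have "(y + ((- (y * u)) mod int n) * w) mod int n = 0" by (simp add: cong_def)
    ultimately have "?g \<otimes>\<^bsub>?B\<^esub> f = \<one>\<^bsub>?B\<^esub>" using id by simp
    moreover have "?g \<in> semidirect_perms n H" by (rule memI[OF w(1)])
    ultimately have "inv\<^bsub>?B\<^esub> f = ?g"
      using carr fP by (intro B.inv_equality) auto
    then show "inv\<^bsub>?B\<^esub> f \<in> semidirect_perms n H" using \<open>?g \<in> _\<close> by simp
  qed
qed

lemma transitive_semidirect_perms:
  assumes "n > 1" "1 \<in> H"
  shows "transitive_perms {0..<int n} (semidirect_perms n H)"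
  unfolding transitive_perms_def
proof (intro ballI)
  fix x y assume xy: "x \<in> {0..<int n}" "y \<in> {0..<int n}"
  have "affine_perm n ((y - x) mod int n) 1 \<in> semidirect_perms n H"
    using assms by (intro affine_perm_in_semidirect_perms) auto
  moreover have "affine_perm n ((y - x) mod int n) 1 x = y"
    using xy by (simp add: mod_add_right_eq)
  ultimately show "\<exists>g \<in> semidirect_perms n H. g x = y" by blast
qed

text \<open>The stabilizer of 0 is \<open>H\<close>. Nontriviality of \<open>H\<close> expresses
  that the action is not regular, and the units \<open>u - 1\<close> express that only the identity
  fixes two points.\<close>

lemma frobenius_semidirect_perms_iff:
  assumes "n > 1" "subgroup H (Zn_units n)"
  shows "frobenius_perm_group (carrier (Zn n)) (semidirect_perms n H) \<longleftrightarrow>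
    H \<noteq> {1} \<and> (\<forall>u \<in> H. u \<noteq> 1 \<longrightarrow> coprime (u - 1) (int n))"
proof
  note H = subgroup_Zn_units_simps[OF assms]
  have n: "n > 0" using assms(1) by simp
  have linear: "affine_perm n 0 u \<in> semidirect_perms n H" if "u \<in> H" for u
    using affine_perm_in_semidirect_perms[OF n that, of 0] by simp
  have linear_one: "u = 1" if "u \<in> H" "affine_perm n 0 u = \<one>\<^bsub>BijGroup {0..<int n}\<^esub>" for u
  proof -
    have "affine_perm n 0 u 1 = 1" using that(2) assms(1) by (simp add: one_BijGroup)
    then show ?thesis using H(2)[OF that(1)] assms(1) by simp
  qed
  {
    assume frob: "frobenius_perm_group (carrier (Zn n)) (semidirect_perms n H)"
    show "H \<noteq> {1} \<and> (\<forall>u \<in> H. u \<noteq> 1 \<longrightarrow> coprime (u - 1) (int n))"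
    proof (intro conjI ballI impI)
      show "H \<noteq> {1}"
      proof
        assume H1: "H = {1}"
        have "regular_perms {0..<int n} (semidirect_perms n H)"
          unfolding regular_perms_def
        proof (intro conjI ballI impI)
          show "transitive_perms {0..<int n} (semidirect_perms n H)"
            using transitive_semidirect_perms[OF assms(1) H(1)] .
          fix g x assume g: "g \<in> semidirect_perms n H" and x: "x \<in> {0..<int n}" "g x = x"
          then obtain y where y: "y \<in> {0..<int n}" "g = affine_perm n y 1"
            using n H1 by (auto simp: semidirect_perms_eq)
          then have "[x + y = x + 0] (mod int n)" using x by (simp add: cong_def)
          then have "[y = 0] (mod int n)" by (simp only: cong_add_lcancel)
          then have "y = 0" using y(1) by (simp add: cong_def)
          then show "g = \<one>\<^bsub>BijGroup {0..<int n}\<^esub>"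
            using y by (auto simp: one_BijGroup restrict_def)
        qed
        then show False using frob n by (simp add: frobenius_perm_group_def carrier_Zn)
      qed
    next
      fix u assume u: "u \<in> H" "u \<noteq> 1"
      show "coprime (u - 1) (int n)"
      proof (rule ccontr)
        assume "\<not> coprime (u - 1) (int n)"
        \<comment> \<open>A common factor \<open>c\<close> of \<open>u - 1\<close> and
          \<open>n\<close> yields the nonzero residue \<open>n / c\<close>, which is annihilated by
          \<open>u - 1\<close> and is thus a second fixed point beside 0.\<close>
        define c where "c = gcd (u - 1) (int n)"
        have dvd: "c dvd u - 1" "c dvd int n" by (simp_all add: c_def)
        have "c \<noteq> 1"
          using \<open>\<not> coprime (u - 1) (int n)\<close> by (simp add: c_def coprime_iff_gcd_eq_1)
        moreover have "c > 0" using n by (simp add: c_def)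
        ultimately have c: "c > 1" by linarith
        define z where "z = int n div c"
        have zc: "z * c = int n" using dvd(2) by (simp add: z_def)
        then have "z > 0" using n c by (metis int_ops(1) less_trans of_nat_less_iff zero_less_mult_pos2 zero_less_one)
        moreover from this have "z * 1 < z * c" using c by (intro mult_strict_left_mono)
        ultimately have z: "z \<in> {0..<int n}" "z \<noteq> 0" using zc by auto
        obtain t where "u - 1 = c * t" using dvd(1) by (elim dvdE)
        then have "z * u = z + int n * t" using zc by (simp add: algebra_simps)
        then have "affine_perm n 0 u z = z" using z by simp
        moreover have "affine_perm n 0 u 0 = 0" using n by simp
        moreover have "0 \<in> {0..<int n}" using n by simp
        ultimately have "affine_perm n 0 u = \<one>\<^bsub>BijGroup {0..<int n}\<^esub>"
          using frob linear[OF u(1)] z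
          unfolding frobenius_perm_group_def carrier_Zn[OF n] by blast
        then show False using linear_one u by blast
      qed
    qed
  next
    assume semi: "H \<noteq> {1} \<and> (\<forall>u \<in> H. u \<noteq> 1 \<longrightarrow> coprime (u - 1) (int n))"
    show "frobenius_perm_group (carrier (Zn n)) (semidirect_perms n H)"
      unfolding frobenius_perm_group_def carrier_Zn[OF n]
    proof (intro conjI ballI impI)
      show "subgroup (semidirect_perms n H) (BijGroup {0..<int n})"
        by (rule subgroup_semidirect_perms[OF assms])
      show "transitive_perms {0..<int n} (semidirect_perms n H)"
        using transitive_semidirect_perms[OF assms(1) H(1)] .
      obtain u where u: "u \<in> H" "u \<noteq> 1" using semi H(1) by blast
      have "affine_perm n 0 u 0 = 0" "0 \<in> {0..<int n}" using n by simp_all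
      then show "\<not> regular_perms {0..<int n} (semidirect_perms n H)"
        using linear_one[OF u(1)] linear[OF u(1)] u(2) unfolding regular_perms_def by blast
    next
      fix g x x' assume g: "g \<in> semidirect_perms n H" and x: "x \<in> {0..<int n}" "x' \<in> {0..<int n}"
        and fixed: "x \<noteq> x' \<and> g x = x \<and> g x' = x'"
      then obtain y u where y: "y \<in> {0..<int n}" "u \<in> H" "g = affine_perm n y u"
        using n by (auto simp: semidirect_perms_eq)
      have e: "[(x + y) * u = x] (mod int n)" "[(x' + y) * u = x'] (mod int n)"
        using fixed x y by (auto simp: cong_def)
      \<comment> \<open>Subtracting the two fixed point equations eliminates the translation part
        \<open>y\<close>.\<close>
      have "[(x + y) * u - (x' + y) * u = x - x'] (mod int n)" by (rule cong_diff[OF e])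
      then have "int n dvd (u - 1) * (x - x')"
        by (simp add: cong_iff_dvd_diff algebra_simps)
      moreover have "\<not> int n dvd x - x'"
        using x fixed by (auto simp: mod_eq_dvd_iff[symmetric])
      ultimately have "\<not> coprime (u - 1) (int n)"
        by (auto simp: coprime_commute coprime_dvd_mult_right_iff)
      then have "u = 1" using semi y(2) by blast
      then have "[x + y = x + 0] (mod int n)" using e by simp
      then have "[y = 0] (mod int n)" by (simp only: cong_add_lcancel)
      then have "y = 0" using y(1) by (simp add: cong_def)
      then show "g = \<one>\<^bsub>BijGroup {0..<int n}\<^esub>"
        using y \<open>u = 1\<close> by (auto simp: one_BijGroup restrict_def)
    qed
  }
qed

subsection \<open>Cayley graphs and automorphisms of the integers modulo n\<close>

lemma connection_set_Zn:
  assumes "n > 0"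
  shows "connection_set (Zn n) S \<longleftrightarrow>
    S \<subseteq> {0..<int n} \<and> 0 \<notin> S \<and> (\<lambda>s. (- s) mod int n) ` S = S"
proof (cases "S \<subseteq> {0..<int n}")
  case True
  then have "set_inv\<^bsub>Zn n\<^esub> S = (\<lambda>s. (- s) mod int n) ` S"
    using assms unfolding SET_INV_def UNION_singleton_eq_range
    by (intro image_cong) (auto simp: carrier_Zn subset_iff)
  then show ?thesis using assms by (simp add: connection_set_def carrier_Zn)
next
  case False
  then show ?thesis using assms by (simp add: connection_set_def carrier_Zn)
qed

lemma has_degree_cayley_graph:
  assumes "n > 0" "S \<subseteq> {0..<int n}"
  shows "has_degree (cayley_graph (Zn n) S) d \<longleftrightarrow> card S = d"
proof -
  have "out_degree (with_proj (cayley_graph (Zn n) S)) v = card S" if v: "v \<in> {0..<int n}" for v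
  proof -
    have "bij_betw (\<lambda>s. (v, (v - s) mod int n)) S
        (out_arcs (with_proj (cayley_graph (Zn n) S)) v)"
    proof (rule bij_betw_byWitness[of _ "\<lambda>e. (v - snd e) mod int n"])
      show "\<forall>s \<in> S. (v - snd (v, (v - s) mod int n)) mod int n = s"
        using assms(2) by (auto simp: mod_diff_right_eq)
      show "\<forall>e \<in> out_arcs (with_proj (cayley_graph (Zn n) S)) v.
          (v, (v - (v - snd e) mod int n) mod int n) = e"
        using assms(1) by (auto simp: out_arcs_def with_proj_def cayley_graph_Zn mod_diff_right_eq)
      show "(\<lambda>s. (v, (v - s) mod int n)) ` S \<subseteq> out_arcs (with_proj (cayley_graph (Zn n) S)) v"
      proof (rule image_subsetI)
        fix s assume s: "s \<in> S"
        have "(v - (v - s) mod int n) mod int n = s"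
          using assms(2) s by (auto simp: mod_diff_right_eq)
        then show "(v, (v - s) mod int n) \<in> out_arcs (with_proj (cayley_graph (Zn n) S)) v"
          using assms(1) v s by (simp add: out_arcs_def with_proj_def cayley_graph_Zn)
      qed
      show "(\<lambda>e. (v - snd e) mod int n) ` out_arcs (with_proj (cayley_graph (Zn n) S)) v \<subseteq> S"
        using assms(1) by (auto simp: out_arcs_def with_proj_def cayley_graph_Zn)
    qed
    then show ?thesis unfolding out_degree_def by (metis bij_betw_same_card)
  qed
  moreover have "0 \<in> {0..<int n}" using assms(1) by simp
  ultimately show ?thesis
    using assms(1) unfolding has_degree_def cayley_graph_Zn[OF assms(1)] by auto
qed

text \<open>One invertible element of \<open>S\<close> is enough: directed steps by
  \<open>- a\<close> already reach every residue, and reachability along arcs passes to the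
  symmetric closure used for connectedness.\<close>

lemma connected_cayley_graph:
  assumes "n > 0" "coprime a (int n)" "a mod int n \<in> S"
  shows "Digraph_Component.connected (with_proj (cayley_graph (Zn n) S))"
proof -
  let ?G = "with_proj (cayley_graph (Zn n) S)"
  interpret wf_digraph ?G
    by unfold_locales (use assms(1) in \<open>auto simp: with_proj_def cayley_graph_Zn\<close>)
  have verts: "verts ?G = {0..<int n}" using assms(1) by (simp add: with_proj_def cayley_graph_Zn)
  have step: "x \<rightarrow>\<^bsub>?G\<^esub> ((x - a) mod int n)" if "x \<in> {0..<int n}" for x
  proof -
    have "(x - (x - a) mod int n) mod int n = a mod int n" by (simp add: mod_diff_right_eq)
    then have "(x, (x - a) mod int n) \<in> arcs ?G"
      using assms that by (simp add: with_proj_def cayley_graph_Zn)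
    then show ?thesis
      unfolding arcs_ends_def arc_to_ends_def by (force simp: with_proj_def)
  qed
  have walk: "x \<rightarrow>\<^sup>*\<^bsub>?G\<^esub> ((x - int k * a) mod int n)" if x: "x \<in> {0..<int n}" for x k
  proof (induction k)
    case 0
    then show ?case using x verts by simp
  next
    case (Suc k)
    have "(x - int k * a) mod int n \<in> {0..<int n}" using assms(1) by simp
    note step[OF this]
    also have "((x - int k * a) mod int n - a) mod int n = (x - int (Suc k) * a) mod int n"
      by (simp add: mod_diff_left_eq algebra_simps)
    finally show ?case using Suc.IH by (rule reachable_adj_trans[rotated])
  qed
  have "x \<rightarrow>\<^sup>*\<^bsub>?G\<^esub> y" if xy: "x \<in> {0..<int n}" "y \<in> {0..<int n}" for x y
  proof -
    obtain w where w: "[a * w = 1] (mod int n)" using cong_solve_coprime_int[OF assms(2)] by blast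
    \<comment> \<open>The length \<open>k\<close> solves \<open>k * a = x - y\<close> modulo
      \<open>n\<close>; reducing modulo \<open>n\<close> makes it nonnegative, as a number of steps
      has to be.\<close>
    define k where "k = nat ((w * (x - y)) mod int n)"
    have k: "int k = (w * (x - y)) mod int n" using assms(1) by (simp add: k_def)
    have "[x - int k * a = x - (w * (x - y)) * a] (mod int n)"
      unfolding k by (intro cong_diff cong_mult cong_refl) simp
    also have "x - (w * (x - y)) * a = x - (a * w) * (x - y)" by (simp add: algebra_simps)
    also have "[\<dots> = x - 1 * (x - y)] (mod int n)"
      by (intro cong_diff cong_mult cong_refl w)
    finally have "(x - int k * a) mod int n = y" using xy(2) by (simp add: cong_def)
    then show ?thesis using walk[OF xy(1), of k] by simp
  qed
  then show ?thesis
    unfolding Digraph_Component.connected_def strongly_connected_def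
    using verts assms(1) by (auto intro: reachable_mk_symmetricI)
qed

lemma unit_aut_in_auto:
  assumes "n > 0" "coprime h (int n)"
  shows "unit_aut n h \<in> auto (Zn n)"
proof -
  have eq: "unit_aut n h = affine_perm n 0 h"
    using assms(1) by (simp add: unit_aut_def carrier_Zn mult.commute)
  have "unit_aut n h \<in> Bij {0..<int n}"
    unfolding eq by (rule affine_perm_Bij[OF assms])
  moreover have "unit_aut n h \<in> hom (Zn n) (Zn n)"
  proof (rule homI)
    fix x y assume "x \<in> carrier (Zn n)" "y \<in> carrier (Zn n)"
    then show "unit_aut n h (x \<otimes>\<^bsub>Zn n\<^esub> y) = unit_aut n h x \<otimes>\<^bsub>Zn n\<^esub> unit_aut n h y"
      using assms(1)
      by (simp add: unit_aut_def carrier_Zn mod_mult_right_eq mod_add_eq distrib_left)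
  qed (use assms(1) in \<open>simp add: unit_aut_def carrier_Zn\<close>)
  ultimately show ?thesis using assms(1) by (simp add: auto_def carrier_Zn)
qed

text \<open>Additivity forces multiplication by the image of 1, and this image is invertible because
  1 itself is attained.\<close>

lemma auto_Zn_imp_unit_aut:
  assumes "n > 1" "\<omega> \<in> auto (Zn n)"
  obtains g where "coprime g (int n)" "\<And>x. x \<in> {0..<int n} \<Longrightarrow> \<omega> x = (g * x) mod int n"
proof -
  have bij: "bij_betw \<omega> {0..<int n} {0..<int n}" and hom: "\<omega> \<in> hom (Zn n) (Zn n)"
    using assms by (auto simp: auto_def Bij_def carrier_Zn)
  have lin: "\<omega> (int k mod int n) = (int k * \<omega> 1) mod int n" for k
  proof (induction k)
    case 0
    interpret group_hom "Zn n" "Zn n" \<omega>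
      by (intro group_hom.intro group_hom_axioms.intro hom) simp_all
    show ?case using hom_one by simp
  next
    case (Suc k)
    have "\<omega> (int (Suc k) mod int n) = \<omega> ((int k mod int n) \<otimes>\<^bsub>Zn n\<^esub> 1)"
      by (simp add: mod_add_left_eq mod_add_right_eq add.commute)
    also have "\<dots> = \<omega> (int k mod int n) \<otimes>\<^bsub>Zn n\<^esub> \<omega> 1"
      using assms(1) by (intro hom_mult[OF hom]) (auto simp: carrier_Zn)
    also have "\<dots> = (int (Suc k) * \<omega> 1) mod int n"
      by (simp add: Suc.IH mod_add_left_eq mod_add_right_eq algebra_simps)
    finally show ?case .
  qed
  have lin': "\<omega> x = (\<omega> 1 * x) mod int n" if "x \<in> {0..<int n}" for x
    using lin[of "nat x"] that by (simp add: mult.commute)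
  have "1 \<in> {0..<int n}" using assms(1) by simp
  then obtain x where x: "x \<in> {0..<int n}" "\<omega> x = 1"
    using bij unfolding bij_betw_def by (metis imageE)
  then have "[\<omega> 1 * x = 1] (mod int n)"
    using lin'[OF x(1)] assms(1) by (simp add: cong_def)
  then have "coprime (\<omega> 1) (int n)" by (metis coprime_iff_invertible_int)
  then show thesis using lin' that by blast
qed

lemma funpow_mult_mod:
  assumes "\<And>x. x \<in> {0..<int n} \<Longrightarrow> \<omega> x = (g * x) mod int n" "n > 0" "s \<in> {0..<int n}"
  shows "(\<omega> ^^ i) s = (s * g ^ i) mod int n"
proof (induction i)
  case 0
  then show ?case using assms(3) by simp
next
  case (Suc i)
  then show ?case using assms(1)[of "(s * g ^ i) mod int n"] assms(2)
    by (simp add: mod_mult_right_eq mult_ac)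
qed

lemma unit_orbit_inj:
  assumes "coprime a (int n)" "S \<subseteq> {0..<int n}"
  shows "inj_on (\<lambda>u. (a * u) mod int n) S"
proof (rule inj_onI)
  fix u v assume uv: "u \<in> S" "v \<in> S" "(a * u) mod int n = (a * v) mod int n"
  then have "u mod int n = v mod int n"
    using mod_mult_cancel_coprime[OF assms(1), of u v] by (simp add: mult.commute)
  then show "u = v" using uv assms(2) by (auto simp: subset_iff)
qed

text \<open>Starting from \<open>a\<close>, the iterates run through \<open>a * h ^ i\<close>. The
  multiplier \<open>h\<close> is allowed to be any integer congruent to \<open>g\<close>, since the
  explicit sum built from primitive roots is not reduced modulo \<open>n\<close>.\<close>

lemma complete_rotation_semiregular_root:
  assumes "semiregular_root n d g" "n > 1" "coprime a (int n)" "[h = g] (mod int n)"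
  shows "complete_rotation (Zn n) (unit_orbit n a (cyclic_units n g)) (unit_aut n h)"
proof -
  have n: "n > 0" using assms(2) by simp
  have h: "semiregular_root n d h" using assms(1) semiregular_root_cong[OF assms(4)] by simp
  have hg: "h mod int n = g mod int n" using assms(4) by (simp add: cong_def)
  then have S: "unit_orbit n a (cyclic_units n g) = (\<lambda>i. (a * h ^ i) mod int n) ` {..<d}"
    using semiregular_root_cyclic_units[OF h assms(2)]
    by (simp add: unit_orbit_def image_image mod_mult_right_eq)
  let ?S = "unit_orbit n a (cyclic_units n g)"
  have cop: "coprime h (int n)" using semiregular_root_coprime[OF h] .
  have d: "d > 0" using h by (simp add: semiregular_root_def)
  have app: "unit_aut n h x = (h * x) mod int n" if "x \<in> {0..<int n}" for x
    using that n by (simp add: unit_aut_def carrier_Zn)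
  have sub: "?S \<subseteq> {0..<int n}" using unit_orbit_subset[OF n] .
  have "cyclic_units n g \<subseteq> {0..<int n}"
    using subgroup.subset[OF subgroup_cyclic_units[OF assms(2) semiregular_root_coprime[OF assms(1)]]]
    assms(2) by (auto simp: carrier_Zn_units)
  then have "card ?S = d"
    using unit_orbit_inj[OF assms(3)] card_semiregular_root[OF assms(1,2)]
    by (simp add: unit_orbit_def card_image)
  have a0: "a mod int n \<in> ?S" unfolding S by (rule image_eqI[of _ _ 0]) (use d in auto)
  have "((unit_aut n h) ^^ i) (a mod int n) = (a * h ^ i) mod int n" for i
    using funpow_mult_mod[of n "unit_aut n h" h "a mod int n" i] app n by (simp add: mod_mult_left_eq)
  then have "(\<lambda>i. ((unit_aut n h) ^^ i) (a mod int n)) ` {..<card ?S} = ?S"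
    unfolding \<open>card ?S = d\<close> by (simp add: S)
  moreover have "unit_aut n h ` ?S = ?S"
  \<comment> \<open>On the finite orbit, injectivity and invariance suffice; for invariance the
    exponent \<open>Suc i\<close> wraps around modulo \<open>d\<close>.\<close>
  proof (rule endo_inj_surj)
    show "finite ?S" using sub by (rule finite_subset) simp
    show "inj_on (unit_aut n h) ?S"
      using unit_orbit_inj[OF cop sub] app sub by (auto simp: inj_on_def subset_iff)
    show "unit_aut n h ` ?S \<subseteq> ?S"
    proof (rule image_subsetI)
      fix x assume "x \<in> ?S"
      then obtain i where x: "x = (a * h ^ i) mod int n" by (auto simp: S)
      have "unit_aut n h x = (a * (h ^ Suc i mod int n)) mod int n"
        using n unfolding x by (simp add: app mod_mult_right_eq mult_ac)
      also have "h ^ Suc i mod int n = h ^ (Suc i mod d) mod int n"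
        by (rule semiregular_root_pow_mod[OF h])
      also have "(a * (h ^ (Suc i mod d) mod int n)) mod int n = (a * h ^ (Suc i mod d)) mod int n"
        by (simp add: mod_mult_right_eq)
      also have "\<dots> \<in> ?S" unfolding S using d by (intro imageI) simp
      finally show "unit_aut n h x \<in> ?S" .
    qed
  qed
  ultimately show ?thesis
    unfolding complete_rotation_def using a0 unit_aut_in_auto[OF n cop] by blast
qed

subsection \<open>Rotational first-kind Frobenius circulants\<close>

lemma one_in_cyclic_units: "n > 1 \<Longrightarrow> coprime g (int n) \<Longrightarrow> 1 \<in> cyclic_units n g"
  using subgroup_Zn_units_simps(1)[OF _ subgroup_cyclic_units] .

lemma generate_unit_orbit:
  assumes "n > 1" "coprime a (int n)" "1 \<in> H"
  shows "generate (Zn n) (unit_orbit n a H) = carrier (Zn n)"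
proof -
  interpret group "Zn n" by simp
  have n: "n > 0" using assms(1) by simp
  have sub: "unit_orbit n a H \<subseteq> carrier (Zn n)"
    using unit_orbit_subset[OF n] by (simp add: carrier_Zn[OF n])
  have a: "a mod int n \<in> unit_orbit n a H" "a mod int n \<in> carrier (Zn n)"
    using assms(3) n by (auto simp: unit_orbit_def carrier_Zn intro!: image_eqI[of _ _ 1])
  have "x \<in> generate (Zn n) (unit_orbit n a H)" if x: "x \<in> carrier (Zn n)" for x
  proof -
    obtain w where w: "[a * w = 1] (mod int n)" using cong_solve_coprime_int[OF assms(2)] by blast
    have "[(w * x) * (a mod int n) = (w * x) * a] (mod int n)"
      by (intro cong_mult cong_refl) simp
    also have "(w * x) * a = (a * w) * x" by (simp add: algebra_simps)
    also have "[\<dots> = 1 * x] (mod int n)" by (intro cong_mult cong_refl w)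
    finally have "(a mod int n) [^]\<^bsub>Zn n\<^esub> (w * x) = x"
      using x n by (simp add: int_pow_integer_mod_group cong_def carrier_Zn)
    then have "x \<in> generate (Zn n) {a mod int n}"
      unfolding generate_pow[OF a(2)] by (intro CollectI exI[of _ "w * x"]) simp
    then show ?thesis using mono_generate[of "{a mod int n}" "unit_orbit n a H"] a(1) by blast
  qed
  then show ?thesis using generate_incl[OF sub] by blast
qed

text \<open>A common divisor of \<open>a\<close> and \<open>n\<close> divides everything generated
  by the orbit, and hence divides 1.\<close>

lemma coprime_of_generate_unit_orbit:
  assumes "n > 1" "generate (Zn n) (unit_orbit n a H) = carrier (Zn n)"
  shows "coprime a (int n)"
proof -
  have n: "n > 0" using assms(1) by simp
  define c where "c = gcd a (int n)"
  have c: "c dvd a" "c dvd int n" by (simp_all add: c_def)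
  have m_inv_eq: "m_inv (Zn n) h = (- h) mod int n" if "h \<in> unit_orbit n a H" for h
    using that unit_orbit_subset[OF n, of a H] by (intro inv_integer_mod_group) (auto simp: carrier_Zn[OF n])
  have "c dvd x" if "x \<in> generate (Zn n) (unit_orbit n a H)" for x
    using that
  proof (induction x rule: generate.induct)
    case (incl h)
    then show ?case using c by (auto simp: unit_orbit_def dvd_mod_iff)
  next
    case (inv h)
    have "c dvd h" using inv.hyps c by (auto simp: unit_orbit_def dvd_mod_iff)
    then show ?case using c m_inv_eq[OF inv.hyps] by (simp add: dvd_mod_iff)
  qed (use c in \<open>simp_all add: dvd_mod_iff\<close>)
  moreover have "1 \<in> carrier (Zn n)" using assms(1) by simp
  ultimately have "c dvd 1" unfolding assms(2) by blast
  then show ?thesis unfolding c_def by (simp add: coprime_iff_gcd_eq_1)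
qed

text \<open>Since \<open>d\<close> is even, -1 is the power \<open>g ^ (d div 2)\<close>, so
  negation only shifts the exponent of \<open>g\<close>. Zero is avoided because all elements of the
  orbit are units.\<close>

lemma connection_set_semiregular_root:
  assumes "n > 1" "semiregular_root n d g" "even d" "coprime a (int n)"
  shows "connection_set (Zn n) (unit_orbit n a (cyclic_units n g))"
proof -
  have n: "n > 0" using assms(1) by simp
  let ?S = "unit_orbit n a (cyclic_units n g)"
  note g = semiregular_root_coprime[OF assms(2)]
  have S: "?S = range (\<lambda>i :: nat. (a * g ^ i) mod int n)"
    using cyclic_units_eq[OF assms(1) g] by (simp add: unit_orbit_def image_image mod_mult_right_eq)
  have "0 \<notin> ?S"
  proof
    assume "0 \<in> ?S"
    then obtain i where "int n dvd a * g ^ i" by (force simp: S)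
    moreover have "coprime (a * g ^ i) (int n)" using g assms(4) by simp
    ultimately have "is_unit (int n)"
      using coprime_common_divisor[of "a * g ^ i" "int n" "int n"] by simp
    then show False using assms(1) by simp
  qed
  moreover have neg: "(- s) mod int n \<in> ?S" if s: "s \<in> ?S" for s
  proof -
    obtain i where i: "s = (a * g ^ i) mod int n" using s by (auto simp: S)
    have "[- s = - (a * g ^ i)] (mod int n)" unfolding i by (simp add: cong_def mod_minus_eq)
    also have "- (a * g ^ i) = a * g ^ i * (- 1)" by simp
    also have "[\<dots> = a * g ^ i * g ^ (d div 2)] (mod int n)"
      by (intro cong_mult cong_refl cong_sym[OF semiregular_root_minus_one[OF assms(2,3)]])
    also have "a * g ^ i * g ^ (d div 2) = a * g ^ (i + d div 2)" by (simp add: power_add)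
    finally have "(- s) mod int n = (a * g ^ (i + d div 2)) mod int n" by (simp add: cong_def)
    then show ?thesis unfolding S by blast
  qed
  have "(\<lambda>s. (- s) mod int n) ` ?S = ?S"
  proof (intro equalityI image_subsetI subsetI)
    fix s assume s: "s \<in> ?S"
    have "s \<in> {0..<int n}" using s unit_orbit_subset[OF n] by blast
    then have "s = (- ((- s) mod int n)) mod int n" by (simp add: mod_minus_eq)
    then show "s \<in> (\<lambda>s. (- s) mod int n) ` ?S" using neg[OF s] by blast
  qed (rule neg)
  ultimately show ?thesis
    using unit_orbit_subset[OF n] by (simp add: connection_set_Zn[OF n])
qed

lemma first_kind_frobenius_semiregular_root:
  assumes "n > 1" "semiregular_root n d g" "even d" "a \<in> {0..<int n}" "coprime a (int n)"
  shows "first_kind_frobenius n (cyclic_units n g) (unit_orbit n a (cyclic_units n g))"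
proof -
  have n: "n > 0" using assms(1) by simp
  let ?H = "cyclic_units n g"
  note g = semiregular_root_coprime[OF assms(2)]
  note sub = subgroup_cyclic_units[OF assms(1) g]
  note one = one_in_cyclic_units[OF assms(1) g]
  have card: "card ?H = d" using card_semiregular_root[OF assms(2,1)] .
  have "d \<noteq> 1" using assms(3) by auto
  then have "?H \<noteq> {1}" using card by auto
  then have "frobenius_perm_group (carrier (Zn n)) (semidirect_perms n ?H)"
    unfolding frobenius_semidirect_perms_iff[OF assms(1) sub]
    using semiregular_root_unit_diff[OF assms(2,1)] by blast
  moreover have "a mod int n \<in> unit_orbit n a ?H"
    unfolding unit_orbit_def by (rule image_eqI[of _ _ 1]) (simp_all add: one)
  ultimately show ?thesis
    unfolding first_kind_frobenius_def
    using sub connection_set_semiregular_root[OF assms(1,2,3,5)]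
      connected_cayley_graph[OF n assms(5)] generate_unit_orbit[OF assms(1,5) one] card assms(3,4)
    by (auto simp: carrier_Zn[OF n] simp del: atLeastLessThan_iff)
qed

lemma first_kind_frobenius_cyclic_semiregular_root:
  assumes "n > 1" "semiregular_root n d g" "even d" "a \<in> {0..<int n}" "coprime a (int n)"
  shows "first_kind_frobenius_cyclic n d (unit_orbit n a (cyclic_units n g))"
proof -
  let ?U = "Zn_units n" and ?H = "cyclic_units n g"
  interpret group ?U by (rule group_Zn_units[OF assms(1)])
  note g = semiregular_root_coprime[OF assms(2)]
  have gU: "g mod int n \<in> carrier ?U" using mod_in_Zn_units[OF assms(1) g] .
  have "generate ?U (carrier ?U \<inter> ?H) = ?H"
    using subgroup.carrier_subgroup_generated_subgroup[OF subgroup_cyclic_units[OF assms(1) g]]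
    by (simp add: carrier_subgroup_generated)
  \<comment> \<open>A subgroup generates only itself, so generating by all of \<open>?H\<close> and
    by the single element \<open>g\<close> give the same group.\<close>
  then have "subgroup_generated ?U ?H = subgroup_generated ?U {g mod int n}"
    using gU by (simp add: subgroup_generated_def)
  then have "cyclic_group (subgroup_generated ?U ?H)"
    using cyclic_group_generated by simp
  then show ?thesis
    unfolding first_kind_frobenius_cyclic_def
    using first_kind_frobenius_semiregular_root[OF assms] card_semiregular_root[OF assms(2,1)] by blast
qed

lemma rotational_frobenius_circulant_semiregular_root:
  assumes "n > 1" "semiregular_root n d g" "even d" "a \<in> {0..<int n}" "coprime a (int n)"
  shows "rotational_frobenius_circulant n d (unit_orbit n a (cyclic_units n g))"
proof -
  have n: "n > 0" using assms(1) by simp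
  let ?H = "cyclic_units n g"
  note g = semiregular_root_coprime[OF assms(2)]
  have "?H \<subseteq> {0..<int n}"
    using subgroup_Zn_units_simps(2)[OF assms(1) subgroup_cyclic_units[OF assms(1) g]] by blast
  then have "card (unit_orbit n a ?H) = d"
    using unit_orbit_inj[OF assms(5)] card_semiregular_root[OF assms(2,1)]
    by (simp add: unit_orbit_def card_image)
  then show ?thesis
    unfolding rotational_frobenius_circulant_def rotational_def
    using first_kind_frobenius_semiregular_root[OF assms]
      complete_rotation_semiregular_root[OF assms(2,1,5) cong_refl]
      has_degree_cayley_graph[OF n unit_orbit_subset[OF n]] by blast
qed

text \<open>Recovers \<open>g ^ d = 1\<close> from a list of the first \<open>d\<close> powers that
  exhausts \<open>H\<close>. Membership of \<open>g\<close> in \<open>H\<close> carries information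
  when \<open>d = 1\<close>, where the list stops before \<open>g\<close>.\<close>

lemma semiregular_rootI:
  assumes "n > 1" "subgroup H (Zn_units n)" "H = (\<lambda>i. g ^ i mod int n) ` {..<d}" "card H = d"
    and "\<And>u. u \<in> H \<Longrightarrow> u \<noteq> 1 \<Longrightarrow> coprime (u - 1) (int n)" "g mod int n \<in> H"
  shows "semiregular_root n d g"
proof -
  note H = subgroup_Zn_units_simps[OF assms(1,2)]
  have inj: "inj_on (\<lambda>i. g ^ i mod int n) {..<d}"
    using assms(3,4) by (intro eq_card_imp_inj_on) auto
  have d: "d > 0" using H(1) assms(3) by (cases "d = 0") auto
  have pow_ne: "g ^ i mod int n \<noteq> 1" if "0 < i" "i < d" for i
    using inj_onD[OF inj, of i 0] that assms(1) by auto
  have "g ^ d mod int n = ((g mod int n) * (g ^ (d - 1) mod int n)) mod int n"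
    using d by (simp add: mod_mult_eq flip: power_Suc)
  also have "\<dots> \<in> H" using assms(3,6) d by (intro H(4)) auto
  \<comment> \<open>By closure \<open>g ^ d\<close> repeats some earlier power \<open>g ^ j\<close>.
    Cancelling gives \<open>g ^ (d - j) = 1\<close>, and the list has no repetition, so
    \<open>j = 0\<close>.\<close>
  finally obtain j where j: "j < d" "g ^ d mod int n = g ^ j mod int n"
    unfolding assms(3) by auto
  have cop: "coprime (g ^ j) (int n)"
    using H(3)[OF assms(6)] assms(1) by simp
  have "[g ^ (d - j) * g ^ j = 1 * g ^ j] (mod int n)"
    using j by (simp add: cong_def flip: power_add)
  then have "[g ^ (d - j) = 1] (mod int n)"
    using cop by (simp only: cong_mult_rcancel coprime_commute)
  then have one: "g ^ (d - j) mod int n = 1" using assms(1) by (simp add: cong_def)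
  then have "j = 0" using pow_ne[of "d - j"] j(1) by (cases "j = 0") auto
  then have "[g ^ d = 1] (mod int n)" using one assms(1) by (simp add: cong_def)
  moreover have "coprime (g ^ i - 1) (int n)" if i: "0 < i" "i < d" for i
  proof -
    have "g ^ i mod int n \<in> H" using assms(3) i by auto
    then have "coprime (g ^ i mod int n - 1) (int n)" using assms(5) pow_ne[OF i] by blast
    moreover have "[g ^ i mod int n - 1 = g ^ i - 1] (mod int n)"
      by (intro cong_diff cong_refl) simp
    ultimately show ?thesis using cong_imp_coprime by blast
  qed
  ultimately show ?thesis using d by (simp add: semiregular_root_def)
qed

lemma unit_orbit_subgroup:
  assumes "n > 1" "subgroup H (Zn_units n)" "h \<in> H"
  shows "unit_orbit n h H = H"
  unfolding unit_orbit_def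
proof (rule endo_inj_surj)
  note H = subgroup_Zn_units_simps[OF assms(1,2)]
  show "finite H" using H(2) by (intro finite_subset[of H "{0..<int n}"]) auto
  show "(\<lambda>u. (h * u) mod int n) ` H \<subseteq> H" using H(4)[OF assms(3)] by auto
  show "inj_on (\<lambda>u. (h * u) mod int n) H"
    using H(2) by (intro unit_orbit_inj H(3)[OF assms(3)]) auto
qed

text \<open>The complete rotation is multiplication by a unit \<open>g\<close>. It preserves
  \<open>a H\<close>, which places \<open>g\<close> in \<open>H\<close>, and its orbit covers
  \<open>a H\<close>, which makes the powers of \<open>g\<close> cover \<open>H\<close>. Cyclicity
  of the complement is thus a consequence of the rotation.\<close>

lemma rotational_frobenius_circulantD:
  assumes "n \<ge> 3" "rotational_frobenius_circulant n d S"
  obtains g a where "even d" "semiregular_root n d g" "a \<in> {0..<int n}" "coprime a (int n)"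
    "S = unit_orbit n a (cyclic_units n g)"
proof -
  have n: "n > 0" "n > 1" using assms(1) by simp_all
  obtain H where fk: "first_kind_frobenius n H S" and rot: "rotational (Zn n) S"
    and deg: "has_degree (cayley_graph (Zn n) S) d"
    using assms(2) unfolding rotational_frobenius_circulant_def by blast
  obtain a where a: "a \<in> carrier (Zn n)" "S = unit_orbit n a H"
      "generate (Zn n) (unit_orbit n a H) = carrier (Zn n)"
      "even (card H) \<or> (a \<noteq> \<one>\<^bsub>Zn n\<^esub> \<and> a \<otimes>\<^bsub>Zn n\<^esub> a = \<one>\<^bsub>Zn n\<^esub>)"
    and sub: "subgroup H (Zn_units n)"
    and frob: "frobenius_perm_group (carrier (Zn n)) (semidirect_perms n H)"
    using fk unfolding first_kind_frobenius_def by blast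
  note H = subgroup_Zn_units_simps[OF n(2) sub]
  have cop: "coprime a (int n)" using coprime_of_generate_unit_orbit[OF n(2) a(3)] .
  have sub': "H \<subseteq> {0..<int n}" "S \<subseteq> {0..<int n}"
    using H(2) a(2) unit_orbit_subset[OF n(1)] by blast+
  have "card S = card H"
    using unit_orbit_inj[OF cop sub'(1)] unfolding a(2) unit_orbit_def by (rule card_image)
  moreover have "card S = d" using deg has_degree_cayley_graph[OF n(1) sub'(2)] by blast
  ultimately have card: "card H = d" "card S = d" by simp_all
  have "even d"
  proof (rule ccontr)
    \<comment> \<open>Only the involution alternative remains: \<open>n\<close> divides
      \<open>2 * a\<close> with \<open>a\<close> a unit, hence \<open>n\<close> divides 2, against
      \<open>n >= 3\<close>.\<close>
    assume "odd d"
    then have "int n dvd a * 2" using a(4) card n by (auto simp: mult_2_right)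
    then have "int n dvd 2" using cop by (simp add: coprime_dvd_mult_right_iff coprime_commute)
    then show False using assms(1) by (auto dest: zdvd_imp_le)
  qed
  obtain \<omega> s where \<omega>: "\<omega> \<in> auto (Zn n)" "\<omega> ` S = S" and s: "s \<in> S" "(\<lambda>i. (\<omega> ^^ i) s) ` {..<card S} = S"
    using rot unfolding rotational_def complete_rotation_def by blast
  obtain g where g: "coprime g (int n)" "\<And>x. x \<in> {0..<int n} \<Longrightarrow> \<omega> x = (g * x) mod int n"
    using auto_Zn_imp_unit_aut[OF n(2) \<omega>(1)] by blast
  obtain h where h: "h \<in> H" "s = (a * h) mod int n" using s(1) unfolding a(2) unit_orbit_def by blast
  have cancel: "x \<in> H" if ax: "(a * x) mod int n \<in> S" and x: "x \<in> {0..<int n}" for x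
  proof -
    obtain u where u: "u \<in> H" "(a * x) mod int n = (a * u) mod int n"
      using ax unfolding a(2) unit_orbit_def by (elim imageE)
    then have "x mod int n = u mod int n"
      using mod_mult_cancel_coprime[OF cop, of x u] by (simp add: mult.commute)
    then have "x = u" using x H(2)[OF u(1)] by simp
    then show ?thesis using u(1) by simp
  qed
  have gH: "g mod int n \<in> H"
  proof (rule cancel)
    have "a mod int n \<in> S" unfolding a(2) unit_orbit_def
      by (rule image_eqI[of _ _ 1]) (simp_all add: H(1))
    then have "\<omega> (a mod int n) \<in> S" using \<omega>(2) by blast
    then show "(a * (g mod int n)) mod int n \<in> S"
      using g(2)[of "a mod int n"] n by (simp add: mod_mult_right_eq mult.commute)
  qed (use n in simp)
  have pow: "g ^ i mod int n \<in> H" for i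
  proof (induction i)
    case 0
    then show ?case using H(1) n by simp
  next
    case (Suc i)
    then show ?case using H(4)[OF gH Suc] by (simp add: mod_mult_eq)
  qed
  have "H \<subseteq> (\<lambda>i. g ^ i mod int n) ` {..<d}"
  proof
    fix u assume u: "u \<in> H"
    \<comment> \<open>The orbit starts at \<open>s = a * h\<close> rather than at \<open>a\<close>,
      so \<open>u\<close> is located by looking up the element \<open>a * h * u\<close> and
      cancelling \<open>a * h\<close>.\<close>
    have "(a * ((h * u) mod int n)) mod int n \<in> S"
      unfolding a(2) unit_orbit_def using H(4)[OF h(1) u] by blast
    then have "(a * ((h * u) mod int n)) mod int n \<in> (\<lambda>i. (\<omega> ^^ i) s) ` {..<d}"
      using s(2) unfolding card(2) by simp
    then obtain i where i: "i < d" "(a * ((h * u) mod int n)) mod int n = (\<omega> ^^ i) s"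
      by auto
    have "(\<omega> ^^ i) s = (s * g ^ i) mod int n"
      by (rule funpow_mult_mod[OF g(2) n(1)]) (use sub' s in auto)
    also have "\<dots> = (a * h * g ^ i) mod int n"
      by (simp add: h(2) mod_mult_left_eq)
    finally have "(u * (a * h)) mod int n = (g ^ i * (a * h)) mod int n"
      using i(2) by (simp add: mod_mult_right_eq mult_ac)
    moreover have "coprime (a * h) (int n)" using cop H(3)[OF h(1)] by simp
    ultimately have "u mod int n = g ^ i mod int n" using mod_mult_cancel_coprime by blast
    then have "u = g ^ i mod int n" using H(2)[OF u] by simp
    then show "u \<in> (\<lambda>i. g ^ i mod int n) ` {..<d}" using i(1) by blast
  qed
  then have Heq: "H = (\<lambda>i. g ^ i mod int n) ` {..<d}" using pow by blast
  have root: "semiregular_root n d g"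
    using frob Heq card gH sub n(2) unfolding frobenius_semidirect_perms_iff[OF n(2) sub]
    by (intro semiregular_rootI[of n H]) blast+
  have "S = unit_orbit n a (cyclic_units n g)"
    using a(2) Heq semiregular_root_cyclic_units[OF root n(2)] by simp
  then show thesis using that \<open>even d\<close> root a(1) cop n(1) by (simp add: carrier_Zn)
qed

section \<open>Isomorphic orbits have equal groups of units\<close>

lemma difference_iso_left_unique:
  assumes "difference_iso n f S T" "difference_iso n f S' T" "n > 0"
    and "S \<subseteq> {0..<int n}" "S' \<subseteq> {0..<int n}"
  shows "S = S'"
proof -
  have "s \<in> S \<longleftrightarrow> s \<in> S'" if s: "s \<in> {0..<int n}" for s
  proof -
    have "0 \<in> {0..<int n}" using assms(3) by simp
    then have "(s - 0) mod int n \<in> S \<longleftrightarrow> (s - 0) mod int n \<in> S'"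
      using assms(1,2) s unfolding difference_iso_def by blast
    then show ?thesis using s by simp
  qed
  then show ?thesis using assms(4,5) by blast
qed

lemma difference_iso_mult:
  assumes "n > 0" "coprime c (int n)" "S \<subseteq> {0..<int n}"
  shows "difference_iso n (\<lambda>x. (c * x) mod int n) S (unit_orbit n c S)"
  unfolding difference_iso_def
proof (intro conjI ballI)
  have inj: "inj_on (\<lambda>x. (c * x) mod int n) {0..<int n}"
    by (rule unit_orbit_inj[OF assms(2)]) simp
  moreover have "(\<lambda>x. (c * x) mod int n) ` {0..<int n} \<subseteq> {0..<int n}" using assms(1) by auto
  ultimately show "bij_betw (\<lambda>x. (c * x) mod int n) {0..<int n} {0..<int n}"
    by (simp add: bij_betw_def endo_inj_surj)
  fix x y
  have "((c * x) mod int n - (c * y) mod int n) mod int n = (c * ((x - y) mod int n)) mod int n"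
    by (simp add: mod_diff_eq mod_mult_right_eq right_diff_distrib)
  moreover have "(c * ((x - y) mod int n)) mod int n \<in> unit_orbit n c S \<longleftrightarrow> (x - y) mod int n \<in> S"
    unfolding unit_orbit_def using assms(1,3) by (intro inj_on_image_mem_iff[OF inj]) auto
  ultimately show "(x - y) mod int n \<in> S \<longleftrightarrow>
      ((c * x) mod int n - (c * y) mod int n) mod int n \<in> unit_orbit n c S" by simp
qed

text \<open>A single isomorphism \<open>f\<close> serves both inclusions, through uniqueness of the
  target set for one and of the source set for the other. The base points \<open>a\<close> and
  \<open>b\<close> do not influence the isomorphism type, as multiplication by a unit moves one to
  the other.\<close>

theorem isomorphic_unit_orbits_iff:
  assumes "n > 1" "subgroup H (Zn_units n)" "subgroup K (Zn_units n)"
    and "coprime a (int n)" "coprime b (int n)"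
  shows "isomorphic_graphs (cayley_graph (Zn n) (unit_orbit n a H))
    (cayley_graph (Zn n) (unit_orbit n b K)) \<longleftrightarrow> H = K"
proof
  have n: "n > 0" using assms(1) by simp
  note H = subgroup_Zn_units_simps[OF assms(1,2)] and K = subgroup_Zn_units_simps[OF assms(1,3)]
  let ?S = "unit_orbit n a H" and ?T = "unit_orbit n b K"
  have absorb: "u \<in> L"
    if "subgroup L (Zn_units n)" "coprime c (int n)" "u \<in> {0..<int n}"
      "unit_orbit n c L = unit_orbit n u (unit_orbit n c L)" for L c u
  proof -
    note L = subgroup_Zn_units_simps[OF assms(1) that(1)]
    have "(u * c * 1) mod int n \<in> unit_orbit n u (unit_orbit n c L)"
      unfolding unit_orbit_unit_orbit unfolding unit_orbit_def using L(1) by (rule imageI)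
    then have "(u * c * 1) mod int n \<in> unit_orbit n c L" unfolding that(4)[symmetric] .
    then obtain v where v: "v \<in> L" "(u * c) mod int n = (v * c) mod int n"
      by (auto simp: unit_orbit_def mult.commute)
    then have "u mod int n = v mod int n" using mod_mult_cancel_coprime[OF that(2)] by blast
    then show ?thesis using v(1) L(2)[OF v(1)] that(3) by simp
  qed
  have fixed: "unit_orbit n u (unit_orbit n c L) = unit_orbit n c L"
    if "subgroup L (Zn_units n)" "u \<in> L" for L c u
    using unit_orbit_subgroup[OF assms(1) that]
    by (metis mult.commute unit_orbit_unit_orbit)
  {
    assume "isomorphic_graphs (cayley_graph (Zn n) ?S) (cayley_graph (Zn n) ?T)"
    then obtain f where f: "difference_iso n f ?S ?T"
      using isomorphic_cayley_graphs_iff[OF n] by blast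
    have mult: "difference_iso n f (unit_orbit n u ?S) (unit_orbit n u ?T)"
      if "u \<in> {0..<int n}" "coprime u (int n)" for u
    proof -
      have "u \<noteq> 0" using that assms(1) by auto
      \<comment> \<open>The multiplier lemma speaks of positive natural numbers, so the residue
        \<open>u\<close> is replaced by its natural representative.\<close>
      then have "nat u > 0" "int (nat u) = u" using that by auto
      moreover from this have "coprime (nat u) n"
        using that(2) by (metis coprime_int_iff)
      ultimately show ?thesis
        using difference_iso_coprime_multiple[OF f, of "nat u"] unit_orbit_subset[OF n] n by simp
    qed
    have "u \<in> K" if u: "u \<in> H" for u
    proof -
      have "difference_iso n f ?S (unit_orbit n u ?T)"
        using mult[OF H(2)[OF u] H(3)[OF u]] fixed[OF assms(2) u] by simp
      then have "?T = unit_orbit n u ?T"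
        using difference_iso_right_unique[OF f _ n] unit_orbit_subset[OF n] by blast
      then show ?thesis using absorb[OF assms(3,5) H(2)[OF u]] by blast
    qed
    moreover have "u \<in> H" if u: "u \<in> K" for u
    proof -
      have "difference_iso n f (unit_orbit n u ?S) ?T"
        using mult[OF K(2)[OF u] K(3)[OF u]] fixed[OF assms(3) u] by simp
      then have "?S = unit_orbit n u ?S"
        using difference_iso_left_unique[OF f _ n] unit_orbit_subset[OF n] by blast
      then show ?thesis using absorb[OF assms(2,4) K(2)[OF u]] by blast
    qed
    ultimately show "H = K" by blast
  next
    assume eq: "H = K"
    obtain w where w: "[a * w = 1] (mod int n)" using cong_solve_coprime_int[OF assms(4)] by blast
    \<comment> \<open>\<open>b * w\<close> is the quotient of \<open>b\<close> by \<open>a\<close>;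
      multiplication by it carries the orbit of \<open>a\<close> to that of
      \<open>b\<close>.\<close>
    have cop: "coprime (b * w) (int n)"
      using w assms(5) by (metis coprime_iff_invertible_int coprime_mult_left_iff mult.commute)
    have "unit_orbit n (b * w) ?S = unit_orbit n (b * w * a) H" by (rule unit_orbit_unit_orbit)
    also have "\<dots> = ?T"
    proof -
      have "[b * w * a * u = b * u] (mod int n)" for u
      proof -
        have "[(b * u) * (a * w) = (b * u) * 1] (mod int n)" by (intro cong_mult cong_refl w)
        then show ?thesis by (simp add: mult_ac)
      qed
      then show ?thesis unfolding unit_orbit_def eq by (intro image_cong) (auto simp: cong_def)
    qed
    finally show "isomorphic_graphs (cayley_graph (Zn n) ?S) (cayley_graph (Zn n) ?T)"
      using difference_iso_mult[OF n cop unit_orbit_subset[OF n], of a H]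
      unfolding isomorphic_cayley_graphs_iff[OF n] by auto
  }
qed

subsection \<open>Orders modulo prime powers\<close>

text \<open>Each further \<open>p\<close>-th power gains one factor \<open>p\<close>: in
  \<open>z ^ p - 1 = (z - 1) * (1 + z + ... + z ^ (p - 1))\<close> the second factor has
  \<open>p\<close> summands, each congruent to 1 modulo \<open>p\<close>.\<close>

lemma cong_one_power_prime_power:
  fixes y :: int
  assumes "[y = 1] (mod int p)"
  shows "[y ^ (p ^ j) = 1] (mod int p ^ Suc j)"
proof (induction j)
  case 0
  then show ?case using assms by simp
next
  case (Suc j)
  define z where "z = y ^ (p ^ j)"
  have "[z = 1 ^ (p ^ j)] (mod int p)" unfolding z_def using assms by (rule cong_pow)
  then have "[(\<Sum>i<p. z ^ i) = (\<Sum>i<p. 1 ^ i)] (mod int p)"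
    by (intro cong_sum cong_pow) simp
  then have "int p dvd (\<Sum>i<p. z ^ i)" by (simp add: cong_def mod_eq_0_iff_dvd)
  moreover have "int p ^ Suc j dvd z - 1" using Suc by (simp only: z_def cong_iff_dvd_diff)
  ultimately have "int p ^ Suc j * int p dvd (z - 1) * (\<Sum>i<p. z ^ i)" by (rule mult_dvd_mono[rotated])
  also have "(z - 1) * (\<Sum>i<p. z ^ i) = z ^ p - 1" by (rule power_diff_1_eq[symmetric])
  also have "z ^ p = y ^ (p ^ Suc j)" by (simp add: z_def mult.commute flip: power_mult)
  finally show ?case by (simp only: cong_iff_dvd_diff power_Suc2)
qed

lemma ord_dvd_ord:
  fixes m n x :: nat
  assumes "m dvd n"
  shows "ord m x dvd ord n x"
  using cong_dvd_modulus_nat[OF ord[of x n] assms] by (simp only: ord_divides)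

text \<open>Lifting from \<open>p\<close> to \<open>p ^ e\<close> costs only an exponent factor
  \<open>p ^ (e - 1)\<close>, and this factor is coprime to \<open>d\<close>, so it can be cancelled
  from the divisibility by the order.\<close>

lemma ord_prime_power_of_dvd:
  fixes p d x e k :: nat
  assumes "prime p" "e > 0" "ord (p ^ e) x = d" "d dvd p - 1" "[x ^ k = 1] (mod p)"
  shows "d dvd k"
proof -
  have "[int x ^ k = 1] (mod int p)"
    using assms(5) by (metis cong_int_iff of_nat_1 of_nat_power)
  from cong_one_power_prime_power[OF this, of "e - 1"]
  have "[int x ^ (k * p ^ (e - 1)) = 1] (mod int p ^ e)"
    using assms(2) by (simp add: power_mult)
  then have "[x ^ (k * p ^ (e - 1)) = 1] (mod p ^ e)"
    by (metis cong_int_iff of_nat_1 of_nat_power)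
  then have "d dvd k * p ^ (e - 1)" using assms(3) by (simp only: ord_divides)
  moreover have "coprime (p - 1) p"
    using prime_gt_0_nat[OF assms(1)] by (rule coprime_diff_one_left_nat)
  then have "coprime d p" using assms(4) by (rule coprime_divisors[OF _ dvd_refl, rotated])
  ultimately show ?thesis by (simp add: coprime_dvd_mult_left_iff)
qed

text \<open>Semiregularity says that no nontrivial power of \<open>x\<close> becomes 1 modulo any
  prime factor, so the order is already \<open>d\<close> modulo \<open>p i\<close>; Fermat then
  gives \<open>d dvd p i - 1\<close>. Conversely, this divisibility keeps the order from dropping
  between \<open>p i ^ e i\<close> and \<open>p i\<close>.\<close>

lemma semiregular_root_prime_factors:
  fixes p e :: "nat \<Rightarrow> nat"
  assumes "\<forall>i \<in> I. prime (p i) \<and> e i > 0" "finite I" "inj_on p I" "n = (\<Prod>i\<in>I. p i ^ e i)"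
  shows "semiregular_root n d (int x) \<longleftrightarrow>
    d > 0 \<and> (\<forall>i \<in> I. ord (p i ^ e i) x = d \<and> d dvd p i - 1)"
proof (intro iffI conjI ballI)
  assume root: "semiregular_root n d (int x)"
  show d: "d > 0" using root by (simp add: semiregular_root_def)
  fix i assume i: "i \<in> I"
  have p: "prime (p i)" "e i > 0" using assms(1) i by auto
  have dvd: "p i ^ e i dvd n" "p i dvd p i ^ e i"
    using assms(2,4) i p by (auto simp: dvd_prodI)
  have "[int (x ^ d) = int 1] (mod int n)" using root by (simp add: semiregular_root_def)
  then have xd: "[x ^ d = 1] (mod n)" by (simp only: cong_int_iff)
  have dvd_d: "ord (p i ^ e i) x dvd d"
    using cong_dvd_modulus_nat[OF xd dvd(1)] by (simp only: ord_divides)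
  have dvd_ord: "ord (p i) x dvd ord (p i ^ e i) x" by (rule ord_dvd_ord[OF dvd(2)])
  have "ord (p i) x dvd d" using dvd_ord dvd_d by (rule dvd_trans)
  have ord: "ord (p i) x = d"
  proof (rule ccontr)
    assume "ord (p i) x \<noteq> d"
    \<comment> \<open>A shorter order \<open>r\<close> modulo \<open>p i\<close> would make
      \<open>p i\<close> a common divisor of \<open>n\<close> and \<open>x ^ r - 1\<close>.\<close>
    then have less: "0 < ord (p i) x" "ord (p i) x < d"
      using \<open>ord (p i) x dvd d\<close> d by (auto simp: order.order_iff_strict dest: dvd_imp_le intro!: Nat.gr0I)
    then have cop: "coprime (int x ^ ord (p i) x - 1) (int n)"
      using root unfolding semiregular_root_def by blast
    have "[int (x ^ ord (p i) x) = int 1] (mod int (p i))"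
      using ord[of x "p i"] by (simp only: cong_int_iff)
    then have "int (p i) dvd int x ^ ord (p i) x - 1" by (simp add: cong_iff_dvd_diff)
    moreover have "int (p i) dvd int n" using dvd dvd_trans by (simp only: int_dvd_int_iff) blast
    ultimately have "is_unit (int (p i))" using cop by (metis coprime_common_divisor)
    then show False using prime_gt_1_nat[OF p(1)] by simp
  qed
  \<comment> \<open>The order modulo the prime power is a multiple of the order \<open>d\<close>
    modulo the prime and divides \<open>d\<close>.\<close>
  show "ord (p i ^ e i) x = d" using dvd_ord dvd_d unfolding ord by (rule dvd_antisym[rotated])
  have "coprime (p i) x" using ord d by (metis ord_gt_0_iff)
  then show "d dvd p i - 1" using order_divides_totient[of "p i" x] ord p by (simp add: totient_prime)
next
  assume *: "d > 0 \<and> (\<forall>i \<in> I. ord (p i ^ e i) x = d \<and> d dvd p i - 1)"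
  have pow: "[x ^ d = 1] (mod p i ^ e i)" if "i \<in> I" for i
    unfolding ord_divides using * that by simp
  have "coprime (p i ^ e i) (p j ^ e j)" if "i \<in> I" "j \<in> I" "i \<noteq> j" for i j
    using assms(1,3) that by (intro coprime_power_left_iff[THEN iffD2] disjI1 coprime_power_right_iff[THEN iffD2])
      (auto intro!: primes_coprime dest: inj_onD)
  then have "[x ^ d = 1] (mod n)"
    unfolding assms(4) using pow by (intro cong_cong_prod_coprime_nat) auto
  then have "[int (x ^ d) = int 1] (mod int n)" by (simp only: cong_int_iff)
  moreover have "coprime (int x ^ k - 1) (int n)" if k: "0 < k" "k < d" for k
  proof -
    have "coprime (int x ^ k - 1) (int (p i ^ e i))" if i: "i \<in> I" for i
    proof -
      have p: "prime (p i)" "e i > 0" using assms(1) i by auto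
      have "\<not> int (p i) dvd int x ^ k - 1"
      proof
        assume "int (p i) dvd int x ^ k - 1"
        then have "[int (x ^ k) = int 1] (mod int (p i))" by (simp add: cong_iff_dvd_diff)
        then have "[x ^ k = 1] (mod p i)" by (simp only: cong_int_iff)
        then have "d dvd k" using ord_prime_power_of_dvd[OF p, of x d k] * i by blast
        then show False using k by (auto dest: dvd_imp_le)
      qed
      then have "coprime (int (p i)) (int x ^ k - 1)" using p(1) by (intro prime_imp_coprime) auto
      then show ?thesis by (simp add: coprime_commute)
    qed
    then show ?thesis unfolding assms(4) of_nat_prod by (intro prod_coprime_right) auto
  qed
  ultimately show "semiregular_root n d (int x)" using * by (simp add: semiregular_root_def)
qed

lemma primroot_power_ord:
  fixes M g d m :: nat
  assumes "residue_primroot M g" "d dvd totient M" "coprime m d"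
  shows "ord M (g ^ (m * (totient M div d))) = d"
proof -
  have g: "coprime M g" "ord M g = totient M" "M > 0" using assms(1) by (auto simp: residue_primroot_def)
  obtain q where q: "totient M = d * q" using assms(2) by blast
  have pos: "d > 0" "q > 0" using q g(3) totient_gt_0_iff[of M] by auto
  have "gcd (m * q) (d * q) = gcd m d * q" by (simp add: gcd_mult_distrib_nat mult.commute)
  then have "gcd (m * q) (d * q) = q" using assms(3) by simp
  then show ?thesis using ord_power[OF g(1), of "m * q"] g(2) q pos by simp
qed

text \<open>With \<open>q = totient M div d\<close>, an exponent k yields order \<open>d\<close>
  exactly when \<open>gcd k (d * q) = q\<close>, that is, when k is \<open>m * q\<close> with
  \<open>m\<close> coprime to \<open>d\<close>. Taking \<open>m\<close> among the totatives makes
  the parametrization injective.\<close>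

lemma primroot_elements_of_ord:
  fixes M g d :: nat
  assumes "residue_primroot M g" "M > 1" "d dvd totient M" "d > 1"
  shows "bij_betw (\<lambda>m. g ^ (m * (totient M div d)) mod M) (totatives d) {x \<in> {..<M}. ord M x = d}"
  unfolding bij_betw_def
proof
  have g: "coprime M g" "ord M g = totient M" using assms(1) by (auto simp: residue_primroot_def)
  obtain q where q: "totient M = d * q" using assms(3) by blast
  have pos: "q > 0" using q assms(2) totient_gt_0_iff[of M] by auto
  have div: "totient M div d = q" using q assms(4) by simp
  have inj: "inj_on (\<lambda>k. g ^ k mod M) {..<d * q}" using inj_power_mod[OF g(1)] g(2) q by simp
  have less: "m < d" if "m \<in> totatives d" for m
    using that assms(4) by (rule totatives_less)
  show "inj_on (\<lambda>m. g ^ (m * (totient M div d)) mod M) (totatives d)"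
  proof (rule inj_onI)
    fix a b assume ab: "a \<in> totatives d" "b \<in> totatives d"
      "g ^ (a * (totient M div d)) mod M = g ^ (b * (totient M div d)) mod M"
    then have "g ^ (a * q) mod M = g ^ (b * q) mod M" unfolding div by blast
    moreover have "a * q \<in> {..<d * q}" "b * q \<in> {..<d * q}"
      using less[OF ab(1)] less[OF ab(2)] pos by simp_all
    ultimately have "a * q = b * q" by (rule inj_onD[OF inj])
    then show "a = b" using pos by simp
  qed
  show "(\<lambda>m. g ^ (m * (totient M div d)) mod M) ` totatives d = {x \<in> {..<M}. ord M x = d}"
  proof (intro equalityI subsetI)
    fix x assume "x \<in> (\<lambda>m. g ^ (m * (totient M div d)) mod M) ` totatives d"
    then obtain m where "m \<in> totatives d" "x = g ^ (m * (totient M div d)) mod M" by blast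
    then show "x \<in> {x \<in> {..<M}. ord M x = d}"
      using primroot_power_ord[OF assms(1,3), of m] assms(2) by (simp add: totatives_def)
  next
    fix x assume x: "x \<in> {x \<in> {..<M}. ord M x = d}"
    then have "ord M x > 0" using assms(4) by simp
    then have "coprime M x" by simp
    moreover have "x \<noteq> 0" using calculation assms(2) by (intro notI) simp
    ultimately have "x \<in> totatives M" using x by (simp add: totatives_def coprime_commute)
    then obtain k where k: "x = g ^ k mod M"
      using bij_betw_imp_surj_on[OF residue_primroot_is_generator[OF assms(2,1)]] by blast
    then have "ord M (g ^ k) = d" using x by simp
    then have "d * gcd k (d * q) = d * q" using ord_power_aux[of M g k] g(2) q by simp
    then have gcd: "gcd k (d * q) = q" using assms(4) by simp
    then have "q dvd k" by (metis gcd_dvd1)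
    then obtain m where m: "k = m * q" by (metis dvdE mult.commute)
    have "gcd m d * q = gcd (m * q) (d * q)" by (simp add: gcd_mult_distrib_nat mult.commute)
    also have "gcd (m * q) (d * q) = 1 * q" using gcd unfolding m by (simp only: mult_1)
    finally have "gcd m d = 1" using pos by (simp only: mult_cancel2) auto
    then have "coprime m d" by (simp only: coprime_iff_gcd_eq_1)
    then have cop: "coprime (m mod d) d" using assms(4) by simp
    \<comment> \<open>Totatives are positive, so the residue 0 has to be excluded;
      \<open>d > 1\<close> does this.\<close>
    moreover have "m mod d \<noteq> 0" using cop assms(4) by (intro notI) simp
    ultimately have tot: "m mod d \<in> totatives d" using assms(4) by (simp add: totatives_def less_imp_le)
    \<comment> \<open>Reducing \<open>m\<close> modulo \<open>d\<close> changes the exponent by a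
      multiple of \<open>d * q\<close>, the order of the primitive root.\<close>
    have "[m mod d * q = m * q] (mod d * q)"
      by (simp add: cong_def mult_mod_left)
    then have "[g ^ (m mod d * q) = g ^ k] (mod M)"
      using order_divides_expdiff[OF g(1)] g(2) q m by simp
    then have "x = g ^ ((m mod d) * (totient M div d)) mod M" unfolding div k by (simp add: cong_def)
    then show "x \<in> (\<lambda>m. g ^ (m * (totient M div d)) mod M) ` totatives d" using tot by blast
  qed
qed

lemma card_elements_of_ord:
  fixes M g d :: nat
  assumes "residue_primroot M g" "M > 1" "d dvd totient M" "d > 1"
  shows "card {x \<in> {..<M}. ord M x = d} = totient d"
  using bij_betw_same_card[OF primroot_elements_of_ord[OF assms]] by (simp add: totient_def)

text \<open>The exponent \<open>m\<close> may be negative. A change of \<open>m\<close> by a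
  multiple of \<open>d\<close> changes the full exponent by a multiple of \<open>totient M\<close>,
  so Euler's theorem reduces the power to one with a natural exponent, where \<open>ord\<close> and
  ordinary powers are available.\<close>

lemma int_pow_Zn_units:
  assumes "M > 1" "coprime M g" "d dvd totient M" "d > 0"
  shows "(int g mod int M) [^]\<^bsub>Zn_units M\<^esub> (m * int (totient M div d)) =
    int (g ^ (nat (m mod int d) * (totient M div d)) mod M)"
proof -
  interpret group "Zn_units M" by (rule group_Zn_units[OF assms(1)])
  let ?x = "int g mod int M" and ?q = "totient M div d"
  have x: "?x \<in> carrier (Zn_units M)"
    using assms(1,2) by (intro mod_in_Zn_units) (auto simp: coprime_commute)
  have nat_pow: "?x [^]\<^bsub>Zn_units M\<^esub> k = int (g ^ k mod M)" for k :: nat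
    by (simp only: pow_Zn_units[OF assms(1)] of_nat_power of_nat_mod)
  have "?x [^]\<^bsub>Zn_units M\<^esub> int (totient M) = \<one>\<^bsub>Zn_units M\<^esub>"
    using euler_theorem[of g M] assms(1,2)
    by (simp add: int_pow_int nat_pow one_Zn_units cong_def coprime_commute)
  then have "?x [^]\<^bsub>Zn_units M\<^esub> (int (totient M) * (m div int d)) = \<one>\<^bsub>Zn_units M\<^esub>"
    using x by (simp flip: int_pow_pow)
  moreover have "m * int ?q = int (totient M) * (m div int d) + int (nat (m mod int d) * ?q)"
  proof -
    have "int (totient M) = int d * int ?q" using assms(3) by (metis dvd_mult_div_cancel of_nat_mult)
    moreover have "m = int d * (m div int d) + m mod int d" by simp
    then have "m * int ?q = int d * int ?q * (m div int d) + (m mod int d) * int ?q"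
      by (metis distrib_right mult.assoc mult.commute)
    ultimately show ?thesis using assms(4) by simp
  qed
  ultimately have "?x [^]\<^bsub>Zn_units M\<^esub> (m * int ?q) = ?x [^]\<^bsub>Zn_units M\<^esub> int (nat (m mod int d) * ?q)"
    using x by (simp add: int_pow_mult)
  then show ?thesis by (simp only: int_pow_int nat_pow)
qed

section \<open>Generators of a semiregular cyclic group\<close>

text \<open>Multiplication by \<open>k\<close> permutes the nonzero exponents modulo
  \<open>d\<close>, so the powers of \<open>g ^ k\<close> to be checked are nontrivial powers of
  \<open>g\<close>.\<close>

lemma semiregular_root_power_coprime:
  assumes "semiregular_root n d g" "coprime k d"
  shows "semiregular_root n d (g ^ k)"
proof -
  have "[(g ^ k) ^ d = 1] (mod int n)"
  proof -
    have "[(g ^ d) ^ k = 1 ^ k] (mod int n)"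
      using assms(1) by (intro cong_pow) (simp add: semiregular_root_def)
    then show ?thesis by (simp add: mult.commute flip: power_mult)
  qed
  moreover have "coprime ((g ^ k) ^ i - 1) (int n)" if i: "0 < i" "i < d" for i
  proof -
    have "\<not> d dvd k * i"
      using assms(2) i by (auto simp: coprime_dvd_mult_right_iff coprime_commute dest: dvd_imp_le)
    then have "0 < (k * i) mod d" "(k * i) mod d < d" using i by (auto simp: mod_greater_zero_iff_not_dvd)
    then have "coprime (g ^ ((k * i) mod d) - 1) (int n)"
      using assms(1) unfolding semiregular_root_def by blast
    moreover have "[g ^ ((k * i) mod d) - 1 = (g ^ k) ^ i - 1] (mod int n)"
      using semiregular_root_pow_mod[OF assms(1), of "k * i"]
      by (intro cong_diff cong_refl) (simp add: cong_def power_mult)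
    ultimately show ?thesis using cong_imp_coprime by blast
  qed
  ultimately show ?thesis using assms(1) by (simp add: semiregular_root_def)
qed

text \<open>If each generator is a power of the other, with exponents \<open>k\<close> and
  \<open>j\<close>, then \<open>k * j = 1\<close> modulo \<open>d\<close>, so \<open>k\<close> is
  coprime to \<open>d\<close>. In the other direction one inclusion is enough, as both groups have
  \<open>d\<close> elements.\<close>

lemma cyclic_units_eq_iff:
  assumes "n > 1" "semiregular_root n d g" "semiregular_root n d h" "d > 1"
  shows "cyclic_units n h = cyclic_units n g \<longleftrightarrow>
    h mod int n \<in> (\<lambda>k. g ^ k mod int n) ` totatives d"
proof
  assume eq: "cyclic_units n h = cyclic_units n g"
  note g = cyclic_units_eq[OF assms(1) semiregular_root_coprime[OF assms(2)]]
  note h = cyclic_units_eq[OF assms(1) semiregular_root_coprime[OF assms(3)]]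
  have "h mod int n \<in> cyclic_units n h" unfolding h by (rule range_eqI[of _ _ 1]) simp
  then obtain k where k: "k < d" "h mod int n = g ^ k mod int n"
    unfolding eq semiregular_root_cyclic_units[OF assms(2,1)] by blast
  have "g mod int n \<in> cyclic_units n g" unfolding g by (rule range_eqI[of _ _ 1]) simp
  then obtain j where j: "g mod int n = h ^ j mod int n"
    unfolding eq[symmetric] h by blast
  have "h ^ j mod int n = (h mod int n) ^ j mod int n" by (simp add: power_mod)
  also have "\<dots> = g ^ (k * j) mod int n" unfolding k(2) by (simp add: power_mod power_mult)
  also have "\<dots> = g ^ ((k * j) mod d) mod int n" by (rule semiregular_root_pow_mod[OF assms(2)])
  finally have "g ^ 1 mod int n = g ^ ((k * j) mod d) mod int n" using j by simp
  then have "1 = (k * j) mod d"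
    using assms(4) by (intro inj_onD[OF semiregular_root_inj[OF assms(2,1)]]) auto
  then have "[k * j = 1] (mod d)" using assms(4) by (simp add: cong_def)
  then have cop: "coprime k d" using coprime_iff_invertible_nat[of k d] by (metis One_nat_def)
  then have "k > 0" using assms(4) by (intro Nat.gr0I) simp
  then have "k \<in> totatives d" using cop k(1) by (simp add: totatives_def)
  then show "h mod int n \<in> (\<lambda>k. g ^ k mod int n) ` totatives d" using k(2) by blast
next
  assume "h mod int n \<in> (\<lambda>k. g ^ k mod int n) ` totatives d"
  then obtain k where k: "h mod int n = g ^ k mod int n" by blast
  have "cyclic_units n h \<subseteq> cyclic_units n g"
    unfolding cyclic_units_eq[OF assms(1) semiregular_root_coprime[OF assms(2)]]
      cyclic_units_eq[OF assms(1) semiregular_root_coprime[OF assms(3)]]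
  proof (rule image_subsetI)
    fix i
    have "h ^ i mod int n = (h mod int n) ^ i mod int n" by (simp add: power_mod)
    also have "\<dots> = g ^ (k * i) mod int n" unfolding k by (simp add: power_mod power_mult)
    finally show "h ^ i mod int n \<in> range (\<lambda>i. g ^ i mod int n)" by blast
  qed
  moreover have "finite (cyclic_units n g)"
    unfolding semiregular_root_cyclic_units[OF assms(2,1)] by simp
  moreover have "card (cyclic_units n h) = card (cyclic_units n g)"
    using card_semiregular_root[OF assms(2,1)] card_semiregular_root[OF assms(3,1)] by simp
  ultimately show "cyclic_units n h = cyclic_units n g" by (intro card_subset_eq)
qed

text \<open>The fibre size in the double count: a group is produced by exactly
  \<open>totient d\<close> roots, whichever group it is.\<close>

lemma card_semiregular_roots_fibre:
  assumes "n > 1" "semiregular_root n d g" "d > 1"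
  shows "card {h \<in> {0..<int n}. semiregular_root n d h \<and> cyclic_units n h = cyclic_units n g} = totient d"
proof -
  have less: "totatives d \<subseteq> {..<d}" using assms(3) by (auto intro: totatives_less)
  have "{h \<in> {0..<int n}. semiregular_root n d h \<and> cyclic_units n h = cyclic_units n g} =
      (\<lambda>k. g ^ k mod int n) ` totatives d"
  proof (intro equalityI subsetI)
    fix h assume "h \<in> {h \<in> {0..<int n}. semiregular_root n d h \<and> cyclic_units n h = cyclic_units n g}"
    then have h: "semiregular_root n d h" "cyclic_units n h = cyclic_units n g" "h mod int n = h"
      by (blast, blast, simp)
    have "h mod int n \<in> (\<lambda>k. g ^ k mod int n) ` totatives d"
      using cyclic_units_eq_iff[OF assms(1,2) h(1) assms(3)] h(2) by blast
    then show "h \<in> (\<lambda>k. g ^ k mod int n) ` totatives d" unfolding h(3) .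
  next
    fix h assume h: "h \<in> (\<lambda>k. g ^ k mod int n) ` totatives d"
    then obtain k where k: "k \<in> totatives d" "h = g ^ k mod int n" by blast
    have "semiregular_root n d (g ^ k)"
      using k(1) by (intro semiregular_root_power_coprime assms(2)) (simp add: totatives_def)
    moreover have "[g ^ k = h] (mod int n)" unfolding k(2) by simp
    ultimately have root: "semiregular_root n d h" using semiregular_root_cong by blast
    have "h mod int n = h" unfolding k(2) by simp
    then have "cyclic_units n h = cyclic_units n g"
      using cyclic_units_eq_iff[OF assms(1,2) root assms(3)] h by simp
    then show "h \<in> {h \<in> {0..<int n}. semiregular_root n d h \<and> cyclic_units n h = cyclic_units n g}"
      using root k(2) assms(1) by simp
  qed
  then show ?thesis
    using card_image[OF inj_on_subset[OF semiregular_root_inj[OF assms(2,1)] less]]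
    by (simp add: totient_def)
qed

subsection \<open>Counting and parametrization by primitive roots\<close>

locale semiregular_factorization =
  fixes n l d :: nat and p e :: "nat \<Rightarrow> nat"
  assumes prime_factors: "\<forall>i \<in> {1..l}. prime (p i) \<and> e i > 0"
    and inj: "inj_on p {1..l}"
    and n_eq: "n = (\<Prod>i = 1..l. p i ^ e i)"
    and n_gt_1: "n > 1"
    and d_gt_1: "d > 1"
    and d_dvd: "\<And>i. i \<in> {1..l} \<Longrightarrow> d dvd p i - 1"
begin

lemma factor_gt_1:
  assumes "i \<in> {1..l}"
  shows "p i ^ e i > 1"
proof -
  have "p i > 1" "e i > 0" using prime_factors assms prime_gt_1_nat by blast+
  then show ?thesis by (rule one_less_power)
qed

lemma mod_factor_less: "i \<in> {1..l} \<Longrightarrow> x mod p i ^ e i < p i ^ e i"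
  by (rule mod_less_divisor, drule factor_gt_1) linarith

lemma factor_dvd: "i \<in> {1..l} \<Longrightarrow> p i ^ e i dvd n"
  unfolding n_eq by (intro dvd_prodI) auto

lemma factors_coprime:
  assumes "i \<in> {1..l}" "j \<in> {1..l}" "i \<noteq> j"
  shows "coprime (p i ^ e i) (p j ^ e j)"
proof -
  have "p i \<noteq> p j" using inj assms by (auto dest: inj_onD)
  then have "coprime (p i) (p j)" using prime_factors assms by (intro primes_coprime) auto
  then show ?thesis by simp
qed

lemma d_dvd_totient: "i \<in> {1..l} \<Longrightarrow> d dvd totient (p i ^ e i)"
  using prime_factors d_dvd[of i] by (simp add: totient_prime_power)

lemma cofactor_eq:
  assumes "i \<in> {1..l}"
  shows "n div p i ^ e i = (\<Prod>j\<in>{1..l} - {i}. p j ^ e j)"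
proof -
  have "n = p i ^ e i * (\<Prod>j\<in>{1..l} - {i}. p j ^ e j)"
    unfolding n_eq using assms by (intro prod.remove) auto
  moreover have "p i ^ e i \<noteq> 0" using factor_gt_1[OF assms] by linarith
  ultimately show ?thesis by (metis nonzero_mult_div_cancel_left)
qed

lemma semiregular_root_iff:
  "semiregular_root n d (int x) \<longleftrightarrow> (\<forall>i \<in> {1..l}. ord (p i ^ e i) x = d)"
  using semiregular_root_prime_factors[OF prime_factors _ inj n_eq, of d x] d_gt_1 d_dvd by auto

text \<open>The coefficients of the sum act as Chinese remainder idempotents: modulo the
  \<open>i\<close>-th factor every other cofactor vanishes, and the \<open>i\<close>-th one is
  cancelled by its inverse \<open>b i\<close>.\<close>

lemma chinese_remainder_sum:
  assumes "i \<in> {1..l}" "[b i * int (n div p i ^ e i) = 1] (mod int (p i ^ e i))"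
  shows "[(\<Sum>j = 1..l. int (n div p j ^ e j) * b j * c j) = c i] (mod int (p i ^ e i))"
proof -
  let ?f = "\<lambda>j. int (n div p j ^ e j) * b j * c j"
  have "(\<Sum>j = 1..l. ?f j) = ?f i + (\<Sum>j\<in>{1..l} - {i}. ?f j)"
    using assms(1) by (intro sum.remove) auto
  also have "[\<dots> = 1 * c i + (\<Sum>j\<in>{1..l} - {i}. 0)] (mod int (p i ^ e i))"
  proof (intro cong_add cong_sum)
    show "[?f i = 1 * c i] (mod int (p i ^ e i))"
      using assms(2) by (intro cong_mult cong_refl) (simp only: mult.commute)
    fix j assume j: "j \<in> {1..l} - {i}"
    then have "p i ^ e i dvd n div p j ^ e j"
      using assms(1) cofactor_eq[of j] by (auto intro!: dvd_prodI)
    then have "int (p i ^ e i) dvd ?f j" by (intro dvd_mult2) (simp only: int_dvd_int_iff)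
    then show "[?f j = 0] (mod int (p i ^ e i))" by (simp only: cong_0_iff)
  qed
  finally show ?thesis by simp
qed

lemma cofactor_inverse:
  assumes "i \<in> {1..l}"
  shows "\<exists>b. [b * int (n div p i ^ e i) = 1] (mod int (p i ^ e i))"
proof -
  have "coprime (\<Prod>j\<in>{1..l} - {i}. p j ^ e j) (p i ^ e i)"
    using assms by (intro prod_coprime_left factors_coprime) auto
  then have "coprime (int (n div p i ^ e i)) (int (p i ^ e i))"
    unfolding cofactor_eq[OF assms] by (simp only: coprime_int_iff)
  then show ?thesis using cong_solve_coprime_int by (metis mult.commute)
qed

text \<open>Modulo each prime power \<open>h\<close> collapses to one power of the primitive root,
  whose order is \<open>d\<close> because \<open>m i\<close> is coprime to \<open>d\<close>.\<close>

lemma rotation_form_semiregular_root: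
  assumes "\<forall>i \<in> {1..l}. residue_primroot (p i ^ e i) (\<eta> i)" "rotation_form n l p e d \<eta> h"
  shows "semiregular_root n d h"
proof -
  obtain b c m where bcm: "\<And>i. i \<in> {1..l} \<Longrightarrow>
      [b i * int (n div p i ^ e i) = 1] (mod int (p i ^ e i)) \<and> coprime (m i) (int d) \<and>
      [c i = (int (\<eta> i) mod int (p i ^ e i)) [^]\<^bsub>Zn_units (p i ^ e i)\<^esub>
        (m i * int (totient (p i ^ e i) div d))] (mod int (p i ^ e i))"
    and h: "h = (\<Sum>i = 1..l. int (n div p i ^ e i) * b i * c i)"
    using assms(2) unfolding rotation_form_def by blast
  \<comment> \<open>\<open>ord\<close> is defined on naturals, so the integer \<open>h\<close> is
    replaced by its natural residue.\<close>
  define x where "x = nat (h mod int n)"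
  have x: "[int x = h] (mod int n)" using n_gt_1 by (simp add: x_def)
  have "ord (p i ^ e i) x = d" if i: "i \<in> {1..l}" for i
  proof -
    let ?M = "p i ^ e i"
    let ?k = "nat (m i mod int d)"
    have root: "residue_primroot ?M (\<eta> i)" using assms(1) i by blast
    then have cop: "coprime ?M (\<eta> i)" by (simp add: residue_primroot_def)
    have "[int x = h] (mod int ?M)"
      using x factor_dvd[OF i] by (intro cong_dvd_modulus[OF x]) (simp only: int_dvd_int_iff)
    also have "[h = c i] (mod int ?M)"
      unfolding h using bcm[OF i] by (intro chinese_remainder_sum[OF i]) blast
    also have "[c i = int (\<eta> i ^ (?k * (totient ?M div d)) mod ?M)] (mod int ?M)"
      using bcm[OF i] int_pow_Zn_units[OF factor_gt_1[OF i] cop d_dvd_totient[OF i], of "m i"] d_gt_1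
      by simp
    finally have "[x = \<eta> i ^ (?k * (totient ?M div d)) mod ?M] (mod ?M)"
      by (simp only: cong_int_iff)
    then have "ord ?M x = ord ?M (\<eta> i ^ (?k * (totient ?M div d)) mod ?M)" by (rule ord_cong)
    also have "\<dots> = ord ?M (\<eta> i ^ (?k * (totient ?M div d)))" by (rule ord_mod)
    also have "\<dots> = d"
    proof (rule primroot_power_ord[OF root d_dvd_totient[OF i]])
      have "coprime (m i mod int d) (int d)" using bcm[OF i] d_gt_1 by (subst coprime_mod_left_iff) auto
      moreover have "int ?k = m i mod int d" using d_gt_1 by simp
      ultimately have "coprime (int ?k) (int d)" by simp
      then show "coprime ?k d" by (simp only: coprime_int_iff)
    qed
    finally show ?thesis .
  qed
  then have "semiregular_root n d (int x)" by (simp add: semiregular_root_iff)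
  then show ?thesis using semiregular_root_cong[OF x] by blast
qed

text \<open>The components of \<open>g\<close> have order \<open>d\<close>, hence are admissible
  powers of the given primitive roots, and the explicit sum reassembles them. The result is only
  congruent to \<open>g\<close>, as the \<open>b i\<close> are arbitrary inverses.\<close>

lemma semiregular_root_rotation_form:
  assumes "\<forall>i \<in> {1..l}. residue_primroot (p i ^ e i) (\<eta> i)" "semiregular_root n d g"
  obtains h where "rotation_form n l p e d \<eta> h" "[h = g] (mod int n)"
proof -
  define x where "x = nat (g mod int n)"
  have x: "[int x = g] (mod int n)" using n_gt_1 by (simp add: x_def)
  then have "semiregular_root n d (int x)" using semiregular_root_cong assms(2) by blast
  then have ord: "ord (p i ^ e i) x = d" if "i \<in> {1..l}" for i
    using that by (simp add: semiregular_root_iff)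
  have "\<exists>k. coprime k d \<and>
      x mod p i ^ e i = \<eta> i ^ (k * (totient (p i ^ e i) div d)) mod p i ^ e i" if i: "i \<in> {1..l}" for i
  proof -
    have "x mod p i ^ e i \<in> {y \<in> {..<p i ^ e i}. ord (p i ^ e i) y = d}"
      using ord[OF i] mod_factor_less[OF i] by simp
    also have "\<dots> = (\<lambda>m. \<eta> i ^ (m * (totient (p i ^ e i) div d)) mod p i ^ e i) ` totatives d"
      using assms(1) i
      by (intro bij_betw_imp_surj_on[symmetric]
          primroot_elements_of_ord factor_gt_1 d_dvd_totient d_gt_1) blast+
    finally obtain m where "m \<in> totatives d"
      "x mod p i ^ e i = \<eta> i ^ (m * (totient (p i ^ e i) div d)) mod p i ^ e i" by blast
    then show ?thesis unfolding totatives_def by blast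
  qed
  then obtain k where k: "\<And>i. i \<in> {1..l} \<Longrightarrow> coprime (k i) d \<and>
      x mod p i ^ e i = \<eta> i ^ (k i * (totient (p i ^ e i) div d)) mod p i ^ e i" by metis
  obtain b where b: "\<And>i. i \<in> {1..l} \<Longrightarrow> [b i * int (n div p i ^ e i) = 1] (mod int (p i ^ e i))"
    using cofactor_inverse by metis
  \<comment> \<open>The component itself serves as the required residue; its expression as a power
    enters only when the form is verified.\<close>
  define c where "c i = int (x mod p i ^ e i)" for i
  define h where "h = (\<Sum>i = 1..l. int (n div p i ^ e i) * b i * c i)"
  have "(int (\<eta> i) mod int (p i ^ e i)) [^]\<^bsub>Zn_units (p i ^ e i)\<^esub>
      (int (k i) * int (totient (p i ^ e i) div d)) = c i" if i: "i \<in> {1..l}" for i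
  proof -
    have "(int (\<eta> i) mod int (p i ^ e i)) [^]\<^bsub>Zn_units (p i ^ e i)\<^esub>
        int (k i * (totient (p i ^ e i) div d)) = c i"
      unfolding int_pow_int pow_Zn_units[OF factor_gt_1[OF i]] c_def
      using k[OF i] by (simp only: of_nat_power of_nat_mod)
    then show ?thesis by simp
  qed
  note pow = this
  have "rotation_form n l p e d \<eta> h"
    unfolding rotation_form_def
  proof (rule exI[of _ b], rule exI[of _ c], rule exI[of _ "\<lambda>i. int (k i)"], intro conjI ballI)
    fix i assume i: "i \<in> {1..l}"
    show "[b i * int (n div p i ^ e i) = 1] (mod int (p i ^ e i))" by (rule b[OF i])
    show "coprime (int (k i)) (int d)" using k[OF i] by (simp only: coprime_int_iff)
    show "[c i = (int (\<eta> i) mod int (p i ^ e i)) [^]\<^bsub>Zn_units (p i ^ e i)\<^esub>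
        (int (k i) * int (totient (p i ^ e i) div d))] (mod int (p i ^ e i))"
      unfolding pow[OF i] by (rule cong_refl)
  qed (rule h_def)
  moreover have "[h = g] (mod int n)"
  proof -
    have "[h = int x] (mod int (p i ^ e i))" if i: "i \<in> {1..l}" for i
    proof -
      have "[h = c i] (mod int (p i ^ e i))"
        unfolding h_def by (rule chinese_remainder_sum[where b = b, OF i b[OF i]])
      also have "[c i = int x] (mod int (p i ^ e i))"
        unfolding c_def by (simp only: cong_def of_nat_mod mod_mod_trivial)
      finally show ?thesis .
    qed
    moreover have "coprime (int (p i ^ e i)) (int (p j ^ e j))"
      if "i \<in> {1..l}" "j \<in> {1..l}" "i \<noteq> j" for i j
      using factors_coprime[OF that] by (simp only: coprime_int_iff)
    ultimately have "[h = int x] (mod (\<Prod>i = 1..l. int (p i ^ e i)))"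
      by (intro cong_cong_prod_coprime) blast+
    then have "[h = int x] (mod int n)" unfolding n_eq of_nat_prod .
    then show ?thesis using x by (rule cong_trans)
  qed
  ultimately show thesis using that by blast
qed

text \<open>An even \<open>d\<close> dividing every \<open>p i - 1\<close> forces all the primes to
  be odd, so each prime power has a primitive root.\<close>

lemma exists_primroots:
  assumes "even d"
  obtains \<eta> where "\<forall>i \<in> {1..l}. residue_primroot (p i ^ e i) (\<eta> i)"
proof -
  have "\<exists>g. residue_primroot (p i ^ e i) g" if i: "i \<in> {1..l}" for i
  proof -
    have p: "prime (p i)" "e i > 0" using prime_factors i by auto
    have "even (p i - 1)" using assms d_dvd[OF i] by (rule dvd_trans)
    then have "odd (p i)" using prime_gt_1_nat[OF p(1)] by simp
    then show ?thesis
      using residue_primroot_odd_prime_power_exists[OF p(1)] p(2) by metis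
  qed
  then show thesis using that by metis
qed

text \<open>Being a semiregular root is a condition on each Chinese remainder component separately,
  so the roots form a product of \<open>l\<close> sets of elements of order \<open>d\<close>, each
  with \<open>totient d\<close> members.\<close>

lemma card_semiregular_roots:
  assumes "even d"
  shows "card {g \<in> {0..<int n}. semiregular_root n d g} = totient d ^ l"
proof -
  obtain \<eta> where \<eta>: "\<forall>i \<in> {1..l}. residue_primroot (p i ^ e i) (\<eta> i)"
    using exists_primroots[OF assms] .
  let ?E = "\<lambda>i. {y \<in> {..<p i ^ e i}. ord (p i ^ e i) y = d}"
  let ?G = "{x \<in> {..<n}. \<forall>i \<in> {1..l}. ord (p i ^ e i) x = d}"
  have bij: "bij_betw (\<lambda>x. \<lambda>i\<in>{1..l}. x mod p i ^ e i) ?G (PiE {1..l} ?E)"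
    unfolding bij_betw_def
  proof
    \<comment> \<open>Uniqueness gives injectivity of the component map and existence gives
      surjectivity.\<close>
    have uniq: "\<exists>!x. x < n \<and> (\<forall>i\<in>{1..l}. [x = y i] (mod p i ^ e i))" for y
      unfolding n_eq
    proof (intro chinese_remainder_unique_nat ballI impI)
      show "p i ^ e i \<noteq> 0" if "i \<in> {1..l}" for i using factor_gt_1[OF that] by linarith
    qed (simp, rule factors_coprime)
    show "inj_on (\<lambda>x. \<lambda>i\<in>{1..l}. x mod p i ^ e i) ?G"
    proof (rule inj_onI)
      fix x y assume xy: "x \<in> ?G" "y \<in> ?G"
        and eq: "(\<lambda>i\<in>{1..l}. x mod p i ^ e i) = (\<lambda>i\<in>{1..l}. y mod p i ^ e i)"
      have "[x = y] (mod p i ^ e i)" if "i \<in> {1..l}" for i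
        using fun_cong[OF eq, of i] that by (simp add: cong_def)
      moreover have "x < n" "y < n" using xy by simp_all
      ultimately show "x = y" using uniq[of "\<lambda>_. y"] cong_refl by blast
    qed
    show "(\<lambda>x. \<lambda>i\<in>{1..l}. x mod p i ^ e i) ` ?G = PiE {1..l} ?E"
    proof (intro equalityI subsetI)
      fix f assume "f \<in> (\<lambda>x. \<lambda>i\<in>{1..l}. x mod p i ^ e i) ` ?G"
      then obtain x where x: "x \<in> ?G" "f = (\<lambda>i\<in>{1..l}. x mod p i ^ e i)" by blast
      have "x mod p i ^ e i \<in> ?E i" if "i \<in> {1..l}" for i
        using x(1) that mod_factor_less[OF that] by simp
      then show "f \<in> PiE {1..l} ?E" unfolding x(2) by simp
    next
      fix f assume f: "f \<in> PiE {1..l} ?E"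
      obtain x where x: "x < n" "\<And>i. i \<in> {1..l} \<Longrightarrow> [x = f i] (mod p i ^ e i)"
        using uniq[of f] by blast
      have fi: "f i < p i ^ e i" "ord (p i ^ e i) (f i) = d" if "i \<in> {1..l}" for i
        using PiE_mem[OF f that] by simp_all
      have "x mod p i ^ e i = f i" if "i \<in> {1..l}" for i
        using x(2)[OF that] fi(1)[OF that] by (simp add: cong_def)
      then have "f = (\<lambda>i\<in>{1..l}. x mod p i ^ e i)"
        using f by (intro extensionalityI[of f "{1..l}"]) (auto simp: PiE_def)
      moreover have "ord (p i ^ e i) x = d" if "i \<in> {1..l}" for i
        using ord_cong[OF x(2)[OF that]] fi(2)[OF that] by simp
      then have "x \<in> ?G" using x(1) by blast
      ultimately show "f \<in> (\<lambda>x. \<lambda>i\<in>{1..l}. x mod p i ^ e i) ` ?G" by blast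
    qed
  qed
  have "card ?G = card (PiE {1..l} ?E)" by (rule bij_betw_same_card[OF bij])
  also have "\<dots> = (\<Prod>i = 1..l. card (?E i))" by (simp add: card_PiE)
  also have "\<dots> = (\<Prod>i = 1..l. totient d)"
    using \<eta> factor_gt_1 d_dvd_totient d_gt_1 by (intro prod.cong refl card_elements_of_ord) auto
  also have "\<dots> = totient d ^ l" by simp
  finally have "card ?G = totient d ^ l" .
  moreover have "{g \<in> {0..<int n}. semiregular_root n d g} = int ` ?G"
  proof (intro equalityI subsetI)
    fix g assume g: "g \<in> {g \<in> {0..<int n}. semiregular_root n d g}"
    then have "g = int (nat g)" by simp
    moreover have "nat g \<in> ?G" using g semiregular_root_iff[of "nat g"] by (simp add: nat_less_iff)
    ultimately show "g \<in> int ` ?G" by blast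
  next
    fix g assume "g \<in> int ` ?G"
    then show "g \<in> {g \<in> {0..<int n}. semiregular_root n d g}" using semiregular_root_iff by auto
  qed
  ultimately show ?thesis by (simp add: card_image)
qed

lemma card_semiregular_cyclic_units:
  assumes "even d" "l > 0"
  shows "card (cyclic_units n ` {g \<in> {0..<int n}. semiregular_root n d g}) = totient d ^ (l - 1)"
proof -
  let ?G = "{g \<in> {0..<int n}. semiregular_root n d g}"
  have "finite ?G" by (rule finite_subset[of _ "{0..<int n}"]) auto
  then have "card ?G = (\<Sum>H\<in>cyclic_units n ` ?G. card {g \<in> ?G. cyclic_units n g = H})"
    unfolding card_eq_sum by (rule sum.image_gen)
  also have "\<dots> = (\<Sum>H\<in>cyclic_units n ` ?G. totient d)"
  proof (rule sum.cong[OF refl])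
    fix H assume "H \<in> cyclic_units n ` ?G"
    then obtain g where g: "semiregular_root n d g" "H = cyclic_units n g" by blast
    have "{h \<in> ?G. cyclic_units n h = H} =
        {h \<in> {0..<int n}. semiregular_root n d h \<and> cyclic_units n h = cyclic_units n g}"
      unfolding g(2) by blast
    then show "card {h \<in> ?G. cyclic_units n h = H} = totient d"
      using card_semiregular_roots_fibre[OF n_gt_1 g(1) d_gt_1] by (simp only:)
  qed
  \<comment> \<open>With \<open>l > 0\<close> the truncated exponent \<open>l - 1\<close> is a true
    predecessor, and the positive factor \<open>totient d\<close> can be cancelled.\<close>
  finally have "card (cyclic_units n ` ?G) * totient d = totient d ^ (l - 1) * totient d"
    using card_semiregular_roots[OF assms(1)] assms(2) by (simp flip: power_Suc2)
  then show ?thesis using d_gt_1 by simp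
qed

end

section \<open>Counting isomorphism classes and assembling the result\<close>

lemma unit_orbit_one: "S \<subseteq> {0..<int n} \<Longrightarrow> unit_orbit n 1 S = S"
  by (force simp: unit_orbit_def image_iff)

lemma cyclic_units_subset:
  assumes "n > 1" "coprime g (int n)"
  shows "cyclic_units n g \<subseteq> {0..<int n}"
  using subgroup_Zn_units_simps(2)[OF assms(1) subgroup_cyclic_units[OF assms]] by blast

lemma rotational_frobenius_circulant_cyclic_units:
  assumes "n > 1" "semiregular_root n d g" "even d"
  shows "rotational_frobenius_circulant n d (cyclic_units n g)"
  using rotational_frobenius_circulant_semiregular_root[OF assms, of 1] assms(1)
    unit_orbit_one[OF cyclic_units_subset[OF assms(1) semiregular_root_coprime[OF assms(2)]]]
  by simp

text \<open>Every class contains exactly one graph whose connection set is the group of units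
  itself, namely the orbit of 1. The criterion \<open>H = K\<close> describes the classes
  directly.\<close>

lemma card_rotational_frobenius_circulants:
  assumes "n \<ge> 3" "even d"
  shows "card (rotational_frobenius_circulants n d //
      {(\<Gamma>, \<Delta>). \<Gamma> \<in> rotational_frobenius_circulants n d \<and>
        \<Delta> \<in> rotational_frobenius_circulants n d \<and> isomorphic_graphs \<Gamma> \<Delta>}) =
    card (cyclic_units n ` {g \<in> {0..<int n}. semiregular_root n d g})"
    (is "card (?C // ?R) = card ?HS")
proof -
  have n: "n > 1" using assms(1) by simp
  have HS: "subgroup H (Zn_units n) \<and> unit_orbit n 1 H = H \<and> cayley_graph (Zn n) H \<in> ?C"
    if H: "H \<in> ?HS" for H
  proof -
    obtain g where g: "semiregular_root n d g" "H = cyclic_units n g" using H by blast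
    note cop = semiregular_root_coprime[OF g(1)]
    show ?thesis
      using subgroup_cyclic_units[OF n cop] unit_orbit_one[OF cyclic_units_subset[OF n cop]]
        rotational_frobenius_circulant_cyclic_units[OF n g(1) assms(2)] g(2)
      unfolding rotational_frobenius_circulants_def by blast
  qed
  have C: "\<exists>H a. H \<in> ?HS \<and> coprime a (int n) \<and> \<Gamma> = cayley_graph (Zn n) (unit_orbit n a H)"
    if C: "\<Gamma> \<in> ?C" for \<Gamma>
  proof -
    obtain S where S: "rotational_frobenius_circulant n d S" "\<Gamma> = cayley_graph (Zn n) S"
      using C unfolding rotational_frobenius_circulants_def by blast
    obtain g a where ga: "semiregular_root n d g" "coprime a (int n)" "S = unit_orbit n a (cyclic_units n g)"
      using rotational_frobenius_circulantD[OF assms(1) S(1)] .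
    \<comment> \<open>\<open>?HS\<close> is indexed by reduced residues, so \<open>g\<close> is
      reduced first; the generated group does not notice.\<close>
    have "semiregular_root n d (g mod int n)"
      using ga(1) semiregular_root_cong[of g "g mod int n" n d] by simp
    then have "cyclic_units n (g mod int n) \<in> ?HS" using n by (intro imageI) simp
    then have "cyclic_units n g \<in> ?HS" by simp
    then show ?thesis using ga S(2) by blast
  qed
  have iso: "isomorphic_graphs (cayley_graph (Zn n) (unit_orbit n a H))
      (cayley_graph (Zn n) (unit_orbit n b K)) \<longleftrightarrow> H = K"
    if "H \<in> ?HS" "K \<in> ?HS" "coprime a (int n)" "coprime b (int n)" for H K a b
    using isomorphic_unit_orbits_iff[OF n _ _ that(3,4)] HS[OF that(1)] HS[OF that(2)] by blast
  have iso1: "isomorphic_graphs (cayley_graph (Zn n) H)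
      (cayley_graph (Zn n) (unit_orbit n b K)) \<longleftrightarrow> H = K"
    if "H \<in> ?HS" "K \<in> ?HS" "coprime b (int n)" for H K b
    using iso[OF that(1,2) coprime_1_left that(3)] HS[OF that(1)] by simp
  have "bij_betw (\<lambda>H. ?R `` {cayley_graph (Zn n) H}) ?HS (?C // ?R)"
    unfolding bij_betw_def
  proof
    show "inj_on (\<lambda>H. ?R `` {cayley_graph (Zn n) H}) ?HS"
    proof (rule inj_onI)
      fix H K assume HK: "H \<in> ?HS" "K \<in> ?HS"
        and eq: "?R `` {cayley_graph (Zn n) H} = ?R `` {cayley_graph (Zn n) K}"
      have "cayley_graph (Zn n) K \<in> ?R `` {cayley_graph (Zn n) K}"
        using iso1[OF HK(2,2) coprime_1_left] HS[OF HK(2)] by simp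
      then have "isomorphic_graphs (cayley_graph (Zn n) H) (cayley_graph (Zn n) K)"
        unfolding eq[symmetric] by simp
      then show "H = K" using iso1[OF HK coprime_1_left] HS[OF HK(2)] by simp
    qed
    show "(\<lambda>H. ?R `` {cayley_graph (Zn n) H}) ` ?HS = ?C // ?R"
    proof (intro equalityI subsetI)
      fix X assume "X \<in> (\<lambda>H. ?R `` {cayley_graph (Zn n) H}) ` ?HS"
      then show "X \<in> ?C // ?R" using HS by (blast intro: quotientI)
    next
      fix X assume "X \<in> ?C // ?R"
      then obtain \<Gamma> where \<Gamma>: "\<Gamma> \<in> ?C" "X = ?R `` {\<Gamma>}" by (rule quotientE)
      obtain H a where H: "H \<in> ?HS" "coprime a (int n)" "\<Gamma> = cayley_graph (Zn n) (unit_orbit n a H)"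
        using C[OF \<Gamma>(1)] by blast
      \<comment> \<open>Both relations amount to \<open>H = K\<close> when \<Delta> arises from
        \<open>K\<close>, so the two graphs have the same class.\<close>
      have "(\<Gamma>, \<Delta>) \<in> ?R \<longleftrightarrow> (cayley_graph (Zn n) H, \<Delta>) \<in> ?R" for \<Delta>
      proof (cases "\<Delta> \<in> ?C")
        case True
        then obtain K b where K: "K \<in> ?HS" "coprime b (int n)" "\<Delta> = cayley_graph (Zn n) (unit_orbit n b K)"
          using C by blast
        show ?thesis
          using iso[OF H(1) K(1) H(2) K(2)] iso1[OF H(1) K(1,2)] HS[OF H(1)] \<Gamma>(1) True
          unfolding H(3) K(3) by simp
      qed simp
      then have "X = ?R `` {cayley_graph (Zn n) H}" unfolding \<Gamma>(2) by blast
      then show "X \<in> (\<lambda>H. ?R `` {cayley_graph (Zn n) H}) ` ?HS" using H(1) by blast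
    qed
  qed
  then show ?thesis by (rule bij_betw_same_card[symmetric])
qed

theorem theorem2p7:
  fixes n l d D :: nat and p e :: "nat \<Rightarrow> nat"
  assumes "n \<ge> 3"
    and "\<forall>i \<in> {1..l}. prime (p i) \<and> e i > 0"
    and "inj_on p {1..l}"
    and "n = (\<Prod>i = 1..l. p i ^ e i)"
    and "D = Gcd ((\<lambda>i. p i - 1) ` {1..l})"
  shows
    "((\<exists>S. rotational_frobenius_circulant n d S) \<longleftrightarrow> odd n \<and> even d \<and> d dvd D) \<and>
     (odd n \<and> even d \<and> d dvd D \<longrightarrow>
        card (rotational_frobenius_circulants n d //
                {(\<Gamma>, \<Delta>). \<Gamma> \<in> rotational_frobenius_circulants n d \<and>
                         \<Delta> \<in> rotational_frobenius_circulants n d \<and> isomorphic_graphs \<Gamma> \<Delta>})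
          = totient d ^ (l - 1) \<and>
        (\<forall>\<eta>. (\<forall>i \<in> {1..l}. residue_primroot (p i ^ e i) (\<eta> i)) \<longrightarrow>
           (\<forall>S. rotational_frobenius_circulant n d S \<longrightarrow>
              (\<exists>h. h mod int n \<in> carrier (Zn_units n) \<and> rotation_form n l p e d \<eta> h \<and>
                   isomorphic_graphs (cayley_graph (Zn n) S)
                     (cayley_graph (Zn n) (cyclic_units n h)) \<and>
                   first_kind_frobenius_cyclic n d S \<and>
                   complete_rotation (Zn n) S (unit_aut n h))) \<and>
           (\<forall>h. rotation_form n l p e d \<eta> h \<longrightarrow>
              h mod int n \<in> carrier (Zn_units n) \<and>
              first_kind_frobenius_cyclic n d (cyclic_units n h) \<and>
              complete_rotation (Zn n) (cyclic_units n h) (unit_aut n h))))"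
proof -
  have n: "n > 1" using assms(1) by simp
  have l: "l > 0"
  proof (rule ccontr)
    assume "\<not> l > 0"
    then have "n = 1" using assms(4) by simp
    then show False using n by simp
  qed
  have dvd_D: "d dvd D \<longleftrightarrow> (\<forall>i \<in> {1..l}. d dvd p i - 1)"
    unfolding assms(5) by (simp add: dvd_Gcd_iff)
  \<comment> \<open>Positivity of \<open>D\<close> rules out \<open>d = 0\<close>, which is even and
    would divide a vanishing \<open>D\<close>.\<close>
  have D_pos: "D > 0"
  proof -
    have "p 1 - 1 \<noteq> 0" using assms(2) l prime_gt_1_nat[of "p 1"] by simp
    moreover have "D dvd p 1 - 1" unfolding assms(5) using l by (intro Gcd_dvd imageI) simp
    ultimately show ?thesis by (intro Nat.gr0I) simp
  qed
  have factorization: "semiregular_factorization n l d p e" if "even d" "d dvd D"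
  proof
    have "d > 0" using that(2) D_pos by (intro Nat.gr0I) simp
    then show "d > 1" using that(1) by (cases "d = 1") auto
  qed (use assms(2-4) n that(2) dvd_D in blast)+
  \<comment> \<open>Oddness of \<open>n\<close> is derived: the even number \<open>d\<close> divides
    each \<open>p i - 1\<close>, so every \<open>p i\<close> is odd.\<close>
  have root_dvd: "odd n \<and> d dvd D" if g: "semiregular_root n d g" and d: "even d" for g
  proof -
    have "[int (nat (g mod int n)) = g] (mod int n)" using n by simp
    then have "semiregular_root n d (int (nat (g mod int n)))" using g semiregular_root_cong by blast
    then have dvd: "d dvd p i - 1" if "i \<in> {1..l}" for i
      using semiregular_root_prime_factors[OF assms(2) _ assms(3,4)] that by blast
    have "odd (p i ^ e i)" if i: "i \<in> {1..l}" for i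
    proof -
      have "even (p i - 1)" using d dvd[OF i] by (rule dvd_trans)
      moreover have "p i > 1" using assms(2) i prime_gt_1_nat by blast
      ultimately show ?thesis by simp
    qed
    then show ?thesis using dvd dvd_D unfolding assms(4) by (simp add: even_prod_iff)
  qed
  have "(\<exists>S. rotational_frobenius_circulant n d S) \<longleftrightarrow> odd n \<and> even d \<and> d dvd D"
  proof
    assume "\<exists>S. rotational_frobenius_circulant n d S"
    then obtain S where "rotational_frobenius_circulant n d S" by blast
    from rotational_frobenius_circulantD[OF assms(1) this]
    show "odd n \<and> even d \<and> d dvd D" using root_dvd by blast
  next
    assume d: "odd n \<and> even d \<and> d dvd D"
    then interpret semiregular_factorization n l d p e using factorization by blast
    \<comment> \<open>Existence is read off from the count \<open>totient d ^ l\<close>, which is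
      positive.\<close>
    have "card {g \<in> {0..<int n}. semiregular_root n d g} \<noteq> 0"
      using card_semiregular_roots d d_gt_1 by simp
    then obtain g where "semiregular_root n d g" by (metis (no_types, lifting) card.empty Collect_empty_eq)
    then show "\<exists>S. rotational_frobenius_circulant n d S"
      using rotational_frobenius_circulant_cyclic_units[OF n] d by blast
  qed
  moreover have "card (rotational_frobenius_circulants n d //
      {(\<Gamma>, \<Delta>). \<Gamma> \<in> rotational_frobenius_circulants n d \<and>
        \<Delta> \<in> rotational_frobenius_circulants n d \<and> isomorphic_graphs \<Gamma> \<Delta>}) = totient d ^ (l - 1)"
    if d: "even d" "d dvd D"
    using semiregular_factorization.card_semiregular_cyclic_units[OF factorization[OF d] d(1) l]
      card_rotational_frobenius_circulants[OF assms(1) d(1)] by (rule trans[rotated])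
  moreover have "\<exists>h. h mod int n \<in> carrier (Zn_units n) \<and> rotation_form n l p e d \<eta> h \<and>
      isomorphic_graphs (cayley_graph (Zn n) S) (cayley_graph (Zn n) (cyclic_units n h)) \<and>
      first_kind_frobenius_cyclic n d S \<and> complete_rotation (Zn n) S (unit_aut n h)"
    if d: "even d" "d dvd D" and \<eta>: "\<forall>i \<in> {1..l}. residue_primroot (p i ^ e i) (\<eta> i)"
      and S: "rotational_frobenius_circulant n d S" for \<eta> S
  proof -
    interpret semiregular_factorization n l d p e by (rule factorization[OF d])
    obtain g a where g: "semiregular_root n d g" and a: "a \<in> {0..<int n}" "coprime a (int n)"
      and S_eq: "S = unit_orbit n a (cyclic_units n g)"
      using rotational_frobenius_circulantD[OF assms(1) S] .
    obtain h where h: "rotation_form n l p e d \<eta> h" "[h = g] (mod int n)"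
      using semiregular_root_rotation_form[OF \<eta> g] .
    note g_cop = semiregular_root_coprime[OF g]
    have "coprime h (int n)" using g_cop cong_imp_coprime[OF cong_sym[OF h(2)]] by blast
    then have "h mod int n \<in> carrier (Zn_units n)" by (rule mod_in_Zn_units[OF n])
    moreover have "cyclic_units n h = cyclic_units n g" using h(2) by (simp add: cong_def)
    then have "cyclic_units n h = unit_orbit n 1 (cyclic_units n g)"
      using unit_orbit_one[OF cyclic_units_subset[OF n g_cop]] by simp
    \<comment> \<open>Both connection sets are orbits of the same group, one through
      \<open>a\<close> and one through 1.\<close>
    then have "isomorphic_graphs (cayley_graph (Zn n) S) (cayley_graph (Zn n) (cyclic_units n h))"
      unfolding S_eq
      using isomorphic_unit_orbits_iff[OF n subgroup_cyclic_units[OF n g_cop]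
          subgroup_cyclic_units[OF n g_cop] a(2) coprime_1_left] by simp
    moreover have "first_kind_frobenius_cyclic n d S"
      unfolding S_eq by (rule first_kind_frobenius_cyclic_semiregular_root[OF n g d(1) a])
    moreover have "complete_rotation (Zn n) S (unit_aut n h)"
      unfolding S_eq by (rule complete_rotation_semiregular_root[OF g n a(2) h(2)])
    ultimately show ?thesis using h(1) by blast
  qed
  moreover have "h mod int n \<in> carrier (Zn_units n) \<and>
      first_kind_frobenius_cyclic n d (cyclic_units n h) \<and>
      complete_rotation (Zn n) (cyclic_units n h) (unit_aut n h)"
    if d: "even d" "d dvd D" and \<eta>: "\<forall>i \<in> {1..l}. residue_primroot (p i ^ e i) (\<eta> i)"
      and h: "rotation_form n l p e d \<eta> h" for \<eta> h
  proof -
    interpret semiregular_factorization n l d p e by (rule factorization[OF d])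
    have root: "semiregular_root n d h" by (rule rotation_form_semiregular_root[OF \<eta> h])
    note cop = semiregular_root_coprime[OF root]
    have eq: "unit_orbit n 1 (cyclic_units n h) = cyclic_units n h"
      by (rule unit_orbit_one[OF cyclic_units_subset[OF n cop]])
    have "1 \<in> {0..<int n}" using n by simp
    from first_kind_frobenius_cyclic_semiregular_root[OF n root d(1) this coprime_1_left]
      complete_rotation_semiregular_root[OF root n coprime_1_left cong_refl]
    show ?thesis using mod_in_Zn_units[OF n cop] by (simp only: eq)
  qed
  ultimately show ?thesis by blast
qed

end
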